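(* Let $K$ be a differential field containing $\mathbb{Q}$ with $n$ commuting derivations $\partial_1,\dots,\partial_n$ and let $D=K[d_1,\dots,d_n]$ be the ring of differential operators with coefficients in $K$. Let $M$ be a differential module over $D$ defined by a first order involutive linear system in the $m$ unknowns $y^1,\dots,y^m$ with no zero order equation. Then the differential module $R=\mathrm{hom}_K(M,K)$ may be generated over $D$ by a finite basis of sections containing $m$ generators.
   Context: Ring: $D=K[d_1,\dots,d_n]$ is the ring of operators $P=a^{\mu}d_{\mu}$ (finite sums, $\mu=(\mu_1,\dots,\mu_n)$ a multi-index, $a^\mu\in K$) with $d_id_j=d_jd_i$ and $d_ia=ad_i+\partial_ia$ for $a\in K$. Module defined by a system: with differential indeterminates $y^1,\dots,y^m$ and jets $y^k_\mu=d_\mu y^k$ (so $d_iy^k_\mu=y^k_{\mu+1_i}$, where $\mu+1_i$ is obtained from $\mu$ by adding $1$ to $\mu_i$), put $Dy=Dy^1+\dots+Dy^m\simeq D^m$. A linear system $\Phi^\tau\equiv a^{\tau\mu}_k y^k_\mu=0$ with coefficients in $K$ defines the left $D$-module $M=Dy/I$, where $I=D\Phi$ is the submodule generated by the $\Phi^\tau$. Sections and $D$-structure on $R$: an element (section) $f\in R=\mathrm{hom}_K(M,K)$ is given by values $f^k_\mu=f(y^k_\mu)\in K$ killed by all the equations in $I$. $R$ is a left $D$-module for the Spencer operator: $(af)(m)=af(m)$ for $a\in K$ and $(d_if)(m)=\partial_i(f(m))-f(d_im)$, that is, $(d_if)^k_\mu=\partial_if^k_\mu-f^k_{\mu+1_i}$.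 Involutive first order system: a first order jet $y^k_i=d_iy^k$ is of class $i$. After a linear change of the independent variables if necessary ($\delta$-regular coordinates), solve the maximum number $\beta^n_1$ of equations with respect to the jets of class $n$, then the maximum number $\beta^{n-1}_1$ of remaining equations with respect to the jets of class $n-1$, and so on down to class $1$. An equation solved with respect to a jet of class $i$ (an equation of class $i$) has multiplicative variables $x^1,\dots,x^i$ and non-multiplicative variables $x^{i+1},\dots,x^n$; any remaining zero order equation has no multiplicative variable. The system is involutive if its first prolongation (the given equations together with all their first formal derivatives $d_i\Phi^\tau$) is obtained by prolonging each equation only with respect to its multiplicative variables.
   Formalization: "Generated over D" is taken order by order: for each section f and each q, some element of the D-span of the m generators agrees with f on all jets of order at most q. Literal generation fails whenever M is infinite dimensional over K (countable versus uncountable dimension). *)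

theory Defs
  imports
    "HOL-Analysis.Cartesian_Space"
    "HOL-Library.Poly_Mapping"
    "HOL-Library.Function_Algebras"
begin

text \<open>
  Conventions. The independent variables are indexed by a finite linearly ordered type \<open>'n\<close>
  (so \<open>n = CARD('n)\<close> and the order is \<open>x\<^sup>1, \<dots>, x\<^sup>n\<close>), the unknowns by a finite type \<open>'m\<close>
  (so \<open>m = CARD('m)\<close>). A multi-index is a function \<open>'n \<Rightarrow> nat\<close>.
\<close>

locale differential_field =
  fixes der :: "'n::finite \<Rightarrow> 'a::field_char_0 \<Rightarrow> 'a"
  assumes der_add: "der i (a + b) = der i a + der i b"
    and der_mult: "der i (a * b) = der i a * b + a * der i b"
    and der_commute: "der i (der j a) = der j (der i a)"

definition incr :: "'n \<Rightarrow> ('n \<Rightarrow> nat) \<Rightarrow> 'n \<Rightarrow> nat" where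
  "incr i \<mu> = \<mu>(i := Suc (\<mu> i))"

definition mi_order :: "('n::finite \<Rightarrow> nat) \<Rightarrow> nat" where
  "mi_order \<mu> = (\<Sum>i\<in>UNIV. \<mu> i)"


subsection \<open>Differential operators\<close>

text \<open>
  An operator \<open>P = a\<^sup>\<mu> d\<^sub>\<mu>\<close> of \<open>D\<close> is given by its coefficients. A left \<open>D\<close>-module is presented by a
  scalar multiplication \<open>s\<close> and operations \<open>d i\<close>; on such a module \<open>P\<close> acts by
  \<open>P z = a\<^sup>\<mu> (d\<^sub>\<mu> z)\<close>. The \<open>d i\<close> commute in all uses below, so the order of composition chosen in
  \<open>dpower\<close> is immaterial.
\<close>

type_synonym ('n, 'a) dop = "('n \<Rightarrow> nat) \<Rightarrow>\<^sub>0 'a"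

definition dpower :: "('n::{finite,linorder} \<Rightarrow> 'v \<Rightarrow> 'v) \<Rightarrow> ('n \<Rightarrow> nat) \<Rightarrow> 'v \<Rightarrow> 'v" where
  "dpower d \<mu> = fold (\<lambda>i. d i ^^ \<mu> i) (sorted_list_of_set UNIV)"

definition dop_apply ::
  "('a::zero \<Rightarrow> 'v \<Rightarrow> 'v::comm_monoid_add) \<Rightarrow> ('n::{finite,linorder} \<Rightarrow> 'v \<Rightarrow> 'v) \<Rightarrow> ('n, 'a) dop \<Rightarrow> 'v \<Rightarrow> 'v"
  where
  "dop_apply s d P z = (\<Sum>\<mu>\<in>Poly_Mapping.keys P. s (Poly_Mapping.lookup P \<mu>) (dpower d \<mu> z))"

definition D_span ::
  "('a::zero \<Rightarrow> 'v \<Rightarrow> 'v::comm_monoid_add) \<Rightarrow> ('n::{finite,linorder} \<Rightarrow> 'v \<Rightarrow> 'v) \<Rightarrow> 'v set \<Rightarrow> 'v set" where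
  "D_span s d X = {\<Sum>x\<in>F. dop_apply s d (P x) x | F P. finite F \<and> F \<subseteq> X}"


subsection \<open>The free module \<open>Dy\<close> and the submodule \<open>I = D\<Phi>\<close>\<close>

text \<open>\<open>Dy\<close> is the \<open>K\<close>-vector space with basis the jets \<open>y\<^sup>k\<^sub>\<mu>\<close>, i.e. the pairs \<open>(k, \<mu>)\<close>.\<close>

type_synonym ('m, 'n, 'a) jetpoly = "('m \<times> ('n \<Rightarrow> nat)) \<Rightarrow>\<^sub>0 'a"

definition jet :: "'m \<Rightarrow> ('n \<Rightarrow> nat) \<Rightarrow> ('m, 'n, 'a::zero_neq_one) jetpoly" where
  "jet k \<mu> = Poly_Mapping.single (k, \<mu>) 1"

abbreviation unknown :: "'m \<Rightarrow> ('m, 'n, 'a::zero_neq_one) jetpoly" where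
  "unknown k \<equiv> jet k (\<lambda>_. 0)"

definition jscale :: "'a::field \<Rightarrow> ('m, 'n, 'a) jetpoly \<Rightarrow> ('m, 'n, 'a) jetpoly" where
  "jscale a = Poly_Mapping.map ((*) a)"

lemma lookup_jscale [simp]:
  "Poly_Mapping.lookup (jscale a P) x = a * Poly_Mapping.lookup P x"
  unfolding jscale_def by (simp add: Poly_Mapping.map.rep_eq when_def)

interpretation Dy: vector_space jscale
  by standard (auto intro!: poly_mapping_eqI simp: lookup_add algebra_simps)

text \<open>\<open>d\<^sub>i (a y\<^sup>k\<^sub>\<mu>) = (\<partial>\<^sub>i a) y\<^sup>k\<^sub>\<mu> + a y\<^sup>k\<close> with index \<open>\<mu> + 1\<^sub>i\<close>.\<close>

definition jderiv ::
  "('n \<Rightarrow> 'a \<Rightarrow> 'a) \<Rightarrow> 'n \<Rightarrow> ('m, 'n, 'a::field) jetpoly \<Rightarrow> ('m, 'n, 'a) jetpoly" where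
  "jderiv der i P = (\<Sum>(k, \<mu>)\<in>Poly_Mapping.keys P.
      Poly_Mapping.single (k, \<mu>) (der i (Poly_Mapping.lookup P (k, \<mu>))) +
      Poly_Mapping.single (k, incr i \<mu>) (Poly_Mapping.lookup P (k, \<mu>)))"

lemma (in differential_field) jderiv_jet: "jderiv der i (jet k \<mu>) = jet k (incr i \<mu>)"
proof -
  have "der i 1 = der i 1 + der i 1" using der_mult[of i 1 1] by simp
  then show ?thesis by (simp add: jderiv_def jet_def)
qed

definition jets_upto :: "nat \<Rightarrow> ('m, 'n::finite, 'a::zero) jetpoly set" where
  "jets_upto q = {P. \<forall>(k, \<mu>)\<in>Poly_Mapping.keys P. mi_order \<mu> \<le> q}"

definition system_module ::
  "('n::{finite,linorder} \<Rightarrow> 'a \<Rightarrow> 'a) \<Rightarrow> ('m, 'n, 'a::field) jetpoly set \<Rightarrow> ('m, 'n, 'a) jetpoly set" where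
  "system_module der \<Phi> = D_span jscale (jderiv der) \<Phi>"


subsection \<open>First order involutive systems\<close>

definition no_zero_order_equation :: "('m, 'n::finite, 'a::field) jetpoly set \<Rightarrow> bool" where
  "no_zero_order_equation \<Phi> \<longleftrightarrow> Dy.span \<Phi> \<inter> jets_upto 0 = {0}"

text \<open>
  A linear change of the independent variables replaces \<open>d\<^sub>1, \<dots>, d\<^sub>n\<close> by the \<open>K\<close>-linear combinations
  \<open>A\<^sub>i\<^sup>j d\<^sub>j\<close>, where \<open>A\<close> is an invertible matrix of constants. The first order jets
  of class \<open>i\<close> in the new variables are then the elements \<open>new_deriv der A i (unknown k)\<close> of \<open>Dy\<close>.
\<close>

definition linear_change :: "('n::finite \<Rightarrow> 'a \<Rightarrow> 'a) \<Rightarrow> (('a::field, 'n) vec, 'n) vec \<Rightarrow> bool" where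
  "linear_change der A \<longleftrightarrow> invertible A \<and> (\<forall>i j l. der l (A $ i $ j) = 0)"

definition new_deriv ::
  "('n::finite \<Rightarrow> 'a \<Rightarrow> 'a) \<Rightarrow> (('a, 'n) vec, 'n) vec \<Rightarrow> 'n \<Rightarrow> ('m, 'n, 'a::field) jetpoly \<Rightarrow> ('m, 'n, 'a) jetpoly" where
  "new_deriv der A i P = (\<Sum>j\<in>UNIV. jscale (A $ i $ j) (jderiv der j P))"

text \<open>
  \<open>S i\<close> is the set of unknowns \<open>k\<close> whose class \<open>i\<close> jet is a principal one, \<open>E i k\<close> the equation
  solved with respect to that jet, and \<open>Z\<close> the set of remaining zero order equations. The remaining
  terms of \<open>E i k\<close> are non-principal jets of class \<open>i\<close>, jets of class less than \<open>i\<close> and jets of order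
  zero. As the equations left after those of class \<open>i\<close> do not contain any jet of class \<open>i\<close>, the number
  \<open>\<beta>\<^sup>i\<^sub>1 = card (S i)\<close> is automatically maximal.
\<close>

definition solved_form ::
  "('n::{finite,linorder} \<Rightarrow> 'a \<Rightarrow> 'a) \<Rightarrow> (('a, 'n) vec, 'n) vec \<Rightarrow> ('m, 'n, 'a::field) jetpoly set \<Rightarrow>
   ('n \<Rightarrow> 'm set) \<Rightarrow> ('n \<Rightarrow> 'm \<Rightarrow> ('m, 'n, 'a) jetpoly) \<Rightarrow> ('m, 'n, 'a) jetpoly set \<Rightarrow> bool" where
  "solved_form der A \<Phi> S E Z \<longleftrightarrow>
     (\<forall>i. \<forall>k\<in>S i. E i k - new_deriv der A i (unknown k) \<in>
        Dy.span ({new_deriv der A i (unknown l) | l. l \<notin> S i} \<union>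
                 {new_deriv der A j (unknown l) | j l. j < i} \<union>
                 range unknown)) \<and>
     Z \<subseteq> jets_upto 0 \<and>
     Dy.span \<Phi> = Dy.span ({E i k | i k. k \<in> S i} \<union> Z)"

text \<open>
  The equation \<open>E i k\<close> of class \<open>i\<close> is prolonged only with respect to the (new) variables \<open>x\<^sup>j\<close> with
  \<open>j \<le> i\<close>, those of \<open>Z\<close> are not prolonged at all.
\<close>

definition involutive ::
  "('n::{finite,linorder} \<Rightarrow> 'a \<Rightarrow> 'a) \<Rightarrow> ('m, 'n, 'a::field) jetpoly set \<Rightarrow> bool" where
  "involutive der \<Phi> \<longleftrightarrow> (\<exists>A S E Z. linear_change der A \<and> solved_form der A \<Phi> S E Z \<and>
     Dy.span (\<Phi> \<union> {jderiv der i P | i P. P \<in> \<Phi>}) =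
     Dy.span (\<Phi> \<union> {new_deriv der A j (E i k) | i j k. k \<in> S i \<and> j \<le> i}))"


subsection \<open>The differential module \<open>R = hom\<^sub>K(M, K)\<close>\<close>

text \<open>
  With \<open>M = Dy/I\<close>, an element of \<open>R\<close> is a \<open>K\<close>-linear map \<open>f\<close> on \<open>Dy\<close> that vanishes on \<open>I\<close>;
  its values are \<open>f\<^sup>k\<^sub>\<mu> = f (jet k \<mu>)\<close>.
\<close>

definition sections ::
  "('n::{finite,linorder} \<Rightarrow> 'a \<Rightarrow> 'a) \<Rightarrow> ('m, 'n, 'a::field) jetpoly set \<Rightarrow> (('m, 'n, 'a) jetpoly \<Rightarrow> 'a) set" where
  "sections der \<Phi> = {f. Vector_Spaces.linear jscale (*) f \<and> (\<forall>P\<in>system_module der \<Phi>. f P = 0)}"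

definition section_scale ::
  "'a::field \<Rightarrow> (('m, 'n, 'a) jetpoly \<Rightarrow> 'a) \<Rightarrow> ('m, 'n, 'a) jetpoly \<Rightarrow> 'a" where
  "section_scale a f = (\<lambda>P. a * f P)"

definition spencer ::
  "('n \<Rightarrow> 'a \<Rightarrow> 'a) \<Rightarrow> 'n \<Rightarrow> (('m, 'n, 'a::field) jetpoly \<Rightarrow> 'a) \<Rightarrow> ('m, 'n, 'a) jetpoly \<Rightarrow> 'a" where
  "spencer der i f = (\<lambda>P. der i (f P) - f (jderiv der i P))"

text \<open>
  \<open>R\<close> is the projective limit of its restrictions to the jets of order at most \<open>q\<close>, and generation
  over \<open>D\<close> is understood with respect to this limit: the \<open>D\<close>-submodule \<open>DG\<close> generated by \<open>G\<close> gives
  all sections at every finite order \<open>q\<close> (equivalently, every section is a convergent, possibly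
  infinite, sum of elements of \<open>DG\<close>). When \<open>M\<close> has finite dimension over \<open>K\<close> this is \<open>R = DG\<close>.
  When \<open>M\<close> has infinite dimension, \<open>R = DG\<close> is impossible for any finite \<open>G\<close>, because \<open>DG\<close> has
  countable and \<open>R\<close> uncountable dimension over \<open>K\<close>.
\<close>

definition generates ::
  "('n::{finite,linorder} \<Rightarrow> 'a \<Rightarrow> 'a) \<Rightarrow> ('m, 'n, 'a::field) jetpoly set \<Rightarrow>
   (('m, 'n, 'a) jetpoly \<Rightarrow> 'a) set \<Rightarrow> bool" where
  "generates der \<Phi> G \<longleftrightarrow> G \<subseteq> sections der \<Phi> \<and>
     (\<forall>f\<in>sections der \<Phi>. \<forall>q. \<exists>h\<in>D_span section_scale (spencer der) G.
        \<forall>k \<mu>. mi_order \<mu> \<le> q \<longrightarrow> h (jet k \<mu>) = f (jet k \<mu>))"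

end

theory Submission
  imports Defs "HOL-Library.Countable"
begin

text \<open>
  Duality turns generation of \<open>R\<close> into a statement about finitely many jets: for each order \<open>q\<close>
  the operators of \<open>D\<close> applied to the chosen sections must produce all linear forms on the image
  of the jets of order at most \<open>q\<close> in \<open>M\<close>. Two facts make \<open>m\<close> sections sufficient.

  \<^item> Involution gives \<open>M\<close> an explicit \<open>K\<close>-basis. In the coordinates in which the system is solved,
  call a jet \<open>y\<^sup>k\<^sub>\<mu>\<close> principal if \<open>\<mu> \<noteq> 0\<close> and the equation of class \<open>i\<close> for \<open>k\<close> is present, where
  \<open>i\<close> is the largest index with \<open>\<mu>\<^sub>i \<noteq> 0\<close>; such a jet is the leading term of exactly one
  multiplicative prolongation of exactly one equation. The other, parametric, jets together with
  these prolongations form a basis of \<open>Dy\<close> (\<open>inj_adapted\<close>, \<open>independent_adapted\<close>), and the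
  multiplicative prolongations span \<open>I\<close> (\<open>dpower_E_in_J\<close>). A section therefore has arbitrary
  values on the parametric jets and is determined by them.

  \<^item> The first variable is multiplicative for every equation, so \<open>d\<^sub>1\<close> maps parametric jets of
  positive order injectively to parametric jets; the same holds for those unknowns that are not
  principal in class 1 (\<open>movable_shift\<close>). Call all these jets movable. If a section has only the values 0 and 1 on parametric
  jets, these values are constants, and the Spencer operator reduces to \<open>(d\<^sub>1\<^sup>r f)(u) = \<plusminus> f(d\<^sub>1\<^sup>r u)\<close>
  for movable \<open>u\<close> (\<open>spencer_op_power_constants\<close>). Put the value 1 at places so sparse that, for every \<open>q\<close> and every
  movable jet of order at most \<open>q\<close>, some shift by \<open>r\<close> brings that jet, and no other movable
  jet of order at most \<open>q\<close>, to a marked place (\<open>sparse_indices_exist\<close>). Then one section alone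
  yields the dual basis of all movable jets.

  What is left are the unknowns that are principal in class 1, and each of them is served by the
  section that is dual to it. The sparse values are attached to the section \<open>g\<^sub>k\<close> of an
  unknown \<open>k\<close> that is itself movable, so the \<open>m\<close> sections \<open>g\<^sub>1, \<dots>, g\<^sub>m\<close> with \<open>g\<^sub>k(y\<^sup>l) = \<delta>\<^sub>k\<^sub>l\<close>
  suffice. If no unknown is movable, there is no parametric jet of positive order at all
  (\<open>positive_order_principal\<close>).

  The hypothesis that there is no zero order equation enters by making the \<open>y\<^sup>k\<close> linearly independent
  in \<open>M\<close>; without it, the values \<open>g\<^sub>k(y\<^sup>l)\<close> could not be prescribed.
\<close>

section \<open>Linear independence of families\<close>

lemma (in vector_space) span_inter_of_independent:
  assumes "independent B" "X \<subseteq> B" "Y \<subseteq> B" "v \<in> span X" "v \<in> span Y"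
  shows "v \<in> span (X \<inter> Y)"
proof -
  let ?r = "representation B v"
  have X: "?r = representation X v" and Y: "?r = representation Y v"
    using assms by (auto intro!: representation_extend)
  have "v \<in> span B" using assms span_mono by blast
  then have v: "(\<Sum>b | ?r b \<noteq> 0. scale (?r b) b) = v"
    using assms(1) by (rule sum_nonzero_representation_eq[rotated])
  have "b \<in> X \<inter> Y" if "?r b \<noteq> 0" for b
    using that X Y representation_ne_zero by (metis IntI)
  then show ?thesis
    by (subst v[symmetric], intro span_sum span_scale span_base) auto
qed

text \<open>
  The exchange bound forces a spanning family with the same finite index set as an independent one
  to be independent without repetitions. This spares every leading term computation when one basis
  of jets is replaced by another.
\<close>

lemma (in vector_space) independent_family_exchange:
  assumes fin: "finite I" and inj: "inj_on u I" and ind: "independent (u ` I)"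
    and sp: "u ` I \<subseteq> span (v ` I)"
  shows "inj_on v I \<and> independent (v ` I)"
proof -
  have cu: "card (u ` I) = card I" using inj by (rule card_image)
  have "card I \<le> card (v ` I)"
    using independent_span_bound[OF _ ind sp] fin cu by auto
  then have ceq: "card (v ` I) = card I"
    using card_image_le[OF fin, of v] by simp
  have "independent (v ` I)"
  proof
    assume "dependent (v ` I)"
    then obtain c where c: "c \<in> v ` I" "c \<in> span (v ` I - {c})"
      unfolding dependent_def by blast
    have "span (v ` I) = span (v ` I - {c})"
      using c by (metis insert_Diff span_redundant)
    then have "card (u ` I) \<le> card (v ` I - {c})"
      using independent_span_bound[of "v ` I - {c}", OF _ ind] sp fin by auto
    moreover have "card (v ` I - {c}) < card (v ` I)"
      using c fin by (intro psubset_card_mono) auto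
    ultimately show False using cu ceq by simp
  qed
  with ceq fin show ?thesis by (simp add: eq_card_imp_inj_on)
qed

lemma (in vector_space) independent_family_filtration:
  fixes ord :: "'i \<Rightarrow> nat"
  assumes fam: "\<And>q. inj_on v {x. ord x \<le> q} \<and> independent (v ` {x. ord x \<le> q})"
  shows "inj v" and "independent (range v)"
proof -
  show "inj v"
  proof (rule injI)
    fix x z assume "v x = v z"
    moreover have "inj_on v {w. ord w \<le> max (ord x) (ord z)}" using fam by blast
    ultimately show "x = z" by (auto dest: inj_onD)
  qed
  have "range v = (\<Union>q. v ` {x. ord x \<le> q})" by auto
  moreover have "independent (\<Union>q. v ` {x. ord x \<le> q})"
  proof (rule independent_Union_directed)
    fix c c' assume "c \<in> range (\<lambda>q. v ` {x. ord x \<le> q})" "c' \<in> range (\<lambda>q. v ` {x. ord x \<le> q})"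
    then obtain p q where "c = v ` {x. ord x \<le> p}" "c' = v ` {x. ord x \<le> q}" by blast
    then show "c \<subseteq> c' \<or> c' \<subseteq> c" by (cases "p \<le> q") auto
  qed (use fam in auto)
  ultimately show "independent (range v)" by simp
qed

lemma (in vector_space) span_imageI: "x \<in> X \<Longrightarrow> f x \<in> span (f ` X)"
  by (simp add: span_base)

section \<open>Multi-indices\<close>

text \<open>
  A derivative with respect to a later variable weighs more, so in an equation of class \<open>i\<close> the
  jets of class \<open>i\<close> outweigh all others. The weights are positive, hence derivatives of lower order
  that the product rule produces are lighter as well, and one number replaces a term order.
\<close>

definition mi_weight :: "('n::{finite,linorder} \<Rightarrow> nat) \<Rightarrow> nat" where
  "mi_weight \<mu> = (\<Sum>i\<in>UNIV. \<mu> i * card {..i})"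

lemma card_atMost_less:
  fixes i j :: "'n::{finite,linorder}"
  shows "i < j \<Longrightarrow> card {..i} < card {..j}"
  by (intro psubset_card_mono) auto

lemma card_atMost_pos: "0 < card {..i::'n::{finite,linorder}}"
  by (simp add: card_gt_0_iff)

lemma sum_incr:
  fixes c :: "'n::finite \<Rightarrow> nat"
  shows "(\<Sum>l\<in>UNIV. incr i \<mu> l * c l) = (\<Sum>l\<in>UNIV. \<mu> l * c l) + c i"
proof -
  have "(\<Sum>l\<in>UNIV. incr i \<mu> l * c l) = (\<Sum>l\<in>UNIV. \<mu> l * c l + (if l = i then c i else 0))"
    by (intro sum.cong) (auto simp: incr_def)
  then show ?thesis by (simp add: sum.distrib)
qed

lemma mi_weight_incr: "mi_weight (incr i \<mu>) = mi_weight \<mu> + card {..i}"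
  by (simp add: mi_weight_def sum_incr)

lemma mi_order_incr [simp]: "mi_order (incr i \<mu>) = Suc (mi_order \<mu>)"
  using sum_incr[of i \<mu> "\<lambda>_. 1"] by (simp add: mi_order_def)

lemma mi_weight_mono: "\<mu> \<le> \<nu> \<Longrightarrow> mi_weight \<mu> \<le> mi_weight \<nu>"
  unfolding mi_weight_def le_fun_def by (intro sum_mono) simp

lemma mi_order_mono: "\<mu> \<le> \<nu> \<Longrightarrow> mi_order \<mu> \<le> mi_order \<nu>"
  unfolding mi_order_def le_fun_def by (intro sum_mono) simp

lemma mi_weight_strict_mono:
  fixes \<mu> \<nu> :: "'n::{finite,linorder} \<Rightarrow> nat"
  assumes "\<mu> \<le> \<nu>" "\<mu> \<noteq> \<nu>" shows "mi_weight \<mu> < mi_weight \<nu>"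
proof -
  obtain i where "\<mu> i \<noteq> \<nu> i" using assms(2) by auto
  with assms(1) have "\<mu> i < \<nu> i" by (simp add: le_fun_def order_less_le)
  with assms(1) card_atMost_pos show ?thesis unfolding mi_weight_def le_fun_def
    by (intro sum_strict_mono_ex1) (auto intro!: bexI[of _ i])
qed

lemma mi_order_zero [simp]: "mi_order (\<lambda>_. 0) = 0"
  by (simp add: mi_order_def)

lemma mi_order_eq_0: "mi_order \<mu> = 0 \<longleftrightarrow> \<mu> = (\<lambda>_. 0)"
  by (auto simp: mi_order_def)

lemma le_mi_order: "\<mu> i \<le> mi_order \<mu>"
  unfolding mi_order_def by (rule member_le_sum) auto

lemma finite_mi_order_le: "finite {\<mu> :: 'n::finite \<Rightarrow> nat. mi_order \<mu> \<le> q}"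
proof (rule finite_subset)
  show "{\<mu> :: 'n \<Rightarrow> nat. mi_order \<mu> \<le> q} \<subseteq> PiE UNIV (\<lambda>_. {..q})"
    by (auto intro: order_trans[OF le_mi_order])
  show "finite (PiE (UNIV :: 'n set) (\<lambda>_. {..q}))" by (intro finite_PiE) auto
qed

lemma finite_jet_index:
  "finite {z :: 'm::finite \<times> ('n::finite \<Rightarrow> nat). mi_order (snd z) \<le> q}"
proof -
  have "{z :: 'm \<times> ('n \<Rightarrow> nat). mi_order (snd z) \<le> q} = UNIV \<times> {\<mu>. mi_order \<mu> \<le> q}" by auto
  then show ?thesis by (simp add: finite_mi_order_le)
qed

lemma incr_commute: "incr i (incr j \<mu>) = incr j (incr i \<mu>)"
  by (auto simp: incr_def fun_eq_iff)

lemma le_incr: "\<mu> \<le> incr i \<mu>"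
  by (simp add: incr_def le_fun_def)

lemma incr_mono: "\<mu> \<le> \<nu> \<Longrightarrow> incr i \<mu> \<le> incr i \<nu>"
  by (simp add: incr_def le_fun_def)

lemma incr_decr: "\<mu> i \<noteq> 0 \<Longrightarrow> incr i (\<mu>(i := \<mu> i - 1)) = \<mu>"
  by (auto simp: incr_def fun_eq_iff)

lemma multi_index_cases:
  obtains (zero) "\<mu> = (\<lambda>_. 0)" | (incr) i \<nu> where "\<mu> = incr i \<nu>"
proof (cases "\<forall>i. \<mu> i = 0")
  case True
  then show ?thesis using zero by (simp add: fun_eq_iff)
next
  case False
  then obtain i where "\<mu> i \<noteq> 0" by blast
  then show ?thesis by (intro incr[of i "\<mu>(i := \<mu> i - 1)"]) (simp only: incr_decr not_False_eq_True)
qed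

lemma multi_index_induct [case_names zero incr]:
  fixes \<mu> :: "'n::finite \<Rightarrow> nat"
  assumes "P (\<lambda>_. 0)" "\<And>i \<mu>. P \<mu> \<Longrightarrow> P (incr i \<mu>)"
  shows "P \<mu>"
proof (induction "mi_order \<mu>" arbitrary: \<mu>)
  case 0 then show ?case using assms(1) by (simp add: mi_order_eq_0)
next
  case (Suc n)
  then show ?case using assms(2) by (cases \<mu> rule: multi_index_cases) auto
qed

section \<open>Differential modules\<close>

context differential_field
begin

lemma der_zero [simp]: "der i 0 = 0"
  using der_add[of i 0 0] by simp

lemma der_one [simp]: "der i 1 = 0"
  using der_mult[of i 1 1] by simp

end

text \<open>
  A left \<open>D\<close>-module is a \<open>K\<close>-vector space with commuting operators that obey
  \<open>d\<^sub>i a = a d\<^sub>i + \<partial>\<^sub>i a\<close>. Both \<open>Dy\<close> and the linear forms with the Spencer operator are instances, and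
  a linear change of the independent variables gives further ones.
\<close>

locale differential_module = differential_field der + vector_space s
  for der :: "'n::{finite,linorder} \<Rightarrow> 'a::field_char_0 \<Rightarrow> 'a"
    and s :: "'a \<Rightarrow> 'v::ab_group_add \<Rightarrow> 'v" +
  fixes d :: "'n \<Rightarrow> 'v \<Rightarrow> 'v"
  assumes d_add: "d i (u + v) = d i u + d i v"
    and d_scale: "d i (s a v) = s (der i a) v + s a (d i v)"
    and d_commute: "d i (d j v) = d j (d i v)"
begin

lemma d_zero [simp]: "d i 0 = 0"
  using d_add[of i 0 0] by simp

lemma d_diff: "d i (u - v) = d i u - d i v"
  using d_add[of i "u - v" v] by simp

lemma d_funpow_commute: "(d i ^^ n) (d j v) = d j ((d i ^^ n) v)"
  by (induction n) (simp_all add: d_commute)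

lemma dpower_d: "dpower d \<mu> (d i v) = d i (dpower d \<mu> v)"
proof -
  have "fold (\<lambda>i. d i ^^ \<mu> i) xs (d i v) = d i (fold (\<lambda>i. d i ^^ \<mu> i) xs v)" for xs
    by (induction xs arbitrary: v) (simp_all add: d_funpow_commute)
  then show ?thesis by (simp add: dpower_def)
qed

lemma dpower_zero_index [simp]: "dpower d (\<lambda>_. 0) v = v"
proof -
  have "fold (\<lambda>i. d i ^^ 0) xs v = v" for xs
    by (induction xs) simp_all
  then show ?thesis by (simp add: dpower_def)
qed

lemma dpower_incr: "dpower d (incr i \<mu>) v = d i (dpower d \<mu> v)"
proof -
  have "distinct xs \<Longrightarrow> fold (\<lambda>j. d j ^^ incr i \<mu> j) xs v =
      (if i \<in> set xs then d i (fold (\<lambda>j. d j ^^ \<mu> j) xs v) else fold (\<lambda>j. d j ^^ \<mu> j) xs v)"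
    for xs
  proof (induction xs arbitrary: v)
    case (Cons j xs)
    have push: "fold (\<lambda>j. d j ^^ \<mu> j) ys (d i w) = d i (fold (\<lambda>j. d j ^^ \<mu> j) ys w)" for ys w
      by (induction ys arbitrary: w) (simp_all add: d_funpow_commute)
    show ?case
    proof (cases "j = i")
      case True
      have "(d j ^^ incr i \<mu> j) v = d i ((d i ^^ \<mu> i) v)" by (simp add: True incr_def)
      with Cons True show ?thesis by (simp add: push)
    next
      case False
      then have "incr i \<mu> j = \<mu> j" by (simp add: incr_def)
      with Cons False show ?thesis by simp
    qed
  qed simp
  then show ?thesis by (simp add: dpower_def)
qed

lemma dpower_diff: "dpower d \<mu> (u - v) = dpower d \<mu> u - dpower d \<mu> v"
  by (induction \<mu> rule: multi_index_induct) (simp_all add: dpower_incr d_diff)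

lemma d_in_span:
  assumes "u \<in> span X" and "\<And>x. x \<in> X \<Longrightarrow> x \<in> span Y" "\<And>x. x \<in> X \<Longrightarrow> d i x \<in> span Y"
  shows "d i u \<in> span Y"
proof -
  have "u \<in> span Y \<and> d i u \<in> span Y"
    using assms(1)
  proof (induction rule: span_induct_alt)
    case (step c x y)
    then show ?case using assms(2,3)
      by (auto simp: d_add d_scale intro!: span_add span_scale)
  qed (simp add: span_zero)
  then show ?thesis ..
qed

text \<open>
  The product rule turns \<open>d\<^sub>\<mu>\<close> of a combination of \<open>X\<close> with coefficients in \<open>K\<close> into a combination of
  the \<open>d\<^sub>\<nu> x\<close> with \<open>\<nu> \<le> \<mu>\<close>. Every use of variable coefficients below goes through this lemma.
\<close>

lemma dpower_in_span:
  assumes "u \<in> span X" and "\<And>x \<mu>'. x \<in> X \<Longrightarrow> \<mu>' \<le> \<mu> \<Longrightarrow> dpower d \<mu>' x \<in> span Y"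
  shows "dpower d \<mu> u \<in> span Y"
proof -
  have "dpower d \<mu> u \<in> span {dpower d \<mu>' x | \<mu>' x. x \<in> X \<and> \<mu>' \<le> \<mu>}"
  proof (induction \<mu> rule: multi_index_induct)
    case zero
    have "X \<subseteq> {dpower d \<mu>' x | \<mu>' x. x \<in> X \<and> \<mu>' \<le> (\<lambda>_. 0)}"
    proof
      fix x assume "x \<in> X"
      moreover have "x = dpower d (\<lambda>_. 0) x" by simp
      ultimately show "x \<in> {dpower d \<mu>' x | \<mu>' x. x \<in> X \<and> \<mu>' \<le> (\<lambda>_. 0)}" by blast
    qed
    then show ?case using assms(1) span_mono by auto
  next
    case (incr i \<mu>)
    show ?case unfolding dpower_incr
    proof (rule d_in_span[OF incr])
      fix z assume "z \<in> {dpower d \<mu>' x | \<mu>' x. x \<in> X \<and> \<mu>' \<le> \<mu>}"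
      then obtain \<mu>' x where z: "z = dpower d \<mu>' x" "x \<in> X" "\<mu>' \<le> \<mu>" by blast
      then show "z \<in> span {dpower d \<mu>' x | \<mu>' x. x \<in> X \<and> \<mu>' \<le> incr i \<mu>}"
        using order_trans[OF z(3) le_incr[of \<mu> i]] by (intro span_base) blast
      from z show "d i z \<in> span {dpower d \<mu>' x | \<mu>' x. x \<in> X \<and> \<mu>' \<le> incr i \<mu>}"
        unfolding z(1) dpower_incr[symmetric]
        using incr_mono[OF z(3), of i] z(2) by (intro span_base) blast
    qed
  qed
  moreover have "span {dpower d \<mu>' x | \<mu>' x. x \<in> X \<and> \<mu>' \<le> \<mu>} \<subseteq> span Y"
    using assms(2) by (intro span_minimal) auto
  ultimately show ?thesis by blast
qed

text \<open>
  As a \<open>K\<close>-span the submodule generated by \<open>X\<close> is visibly closed under the \<open>d\<^sub>i\<close>;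
  \<open>D_span_eq_D_submodule\<close> identifies it with the set of all \<open>\<Sum> P\<^sub>x x\<close>.
\<close>

definition D_submodule :: "'v set \<Rightarrow> 'v set" where
  "D_submodule X = span {dpower d \<mu> x | \<mu> x. x \<in> X}"

lemma subset_D_submodule: "X \<subseteq> D_submodule X"
proof
  fix x assume "x \<in> X"
  moreover have "x = dpower d (\<lambda>_. 0) x" by simp
  ultimately show "x \<in> D_submodule X" unfolding D_submodule_def by (intro span_base) blast
qed

lemma subspace_D_submodule: "subspace (D_submodule X)"
  by (simp add: D_submodule_def)

lemma d_D_submodule: "u \<in> D_submodule X \<Longrightarrow> d i u \<in> D_submodule X"
  unfolding D_submodule_def
proof (erule d_in_span)
  fix z assume "z \<in> {dpower d \<mu> x | \<mu> x. x \<in> X}"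
  then obtain \<mu> x where z: "z = dpower d \<mu> x" "x \<in> X" by blast
  show "d i z \<in> span {dpower d \<mu> x | \<mu> x. x \<in> X}"
    unfolding z(1) dpower_incr[symmetric] using z(2) by (intro span_base) blast
qed (rule span_base)

lemma D_submodule_minimal:
  assumes "X \<subseteq> V" "subspace V" "\<And>i v. v \<in> V \<Longrightarrow> d i v \<in> V"
  shows "D_submodule X \<subseteq> V"
proof -
  have "dpower d \<mu> x \<in> V" if "x \<in> X" for \<mu> x
    using assms(1,3) that by (induction \<mu> rule: multi_index_induct) (auto simp: dpower_incr)
  then show ?thesis unfolding D_submodule_def using assms(2) by (intro span_minimal) auto
qed

lemma dop_apply_superset:
  assumes "finite M" "Poly_Mapping.keys P \<subseteq> M"
  shows "dop_apply s d P z = (\<Sum>\<mu>\<in>M. s (Poly_Mapping.lookup P \<mu>) (dpower d \<mu> z))"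
  unfolding dop_apply_def using assms
  by (intro sum.mono_neutral_left) (auto simp: in_keys_iff)

lemma dop_apply_add: "dop_apply s d (P + Q) z = dop_apply s d P z + dop_apply s d Q z"
proof -
  let ?M = "Poly_Mapping.keys P \<union> Poly_Mapping.keys Q"
  have "Poly_Mapping.keys (P + Q) \<subseteq> ?M" by (rule Poly_Mapping.keys_add)
  then show ?thesis
    by (simp add: dop_apply_superset[of ?M] lookup_add scale_left_distrib sum.distrib)
qed

lemma dop_apply_zero [simp]: "dop_apply s d 0 z = 0"
  by (simp add: dop_apply_def)

lemma dop_apply_single: "dop_apply s d (Poly_Mapping.single \<mu> a) z = s a (dpower d \<mu> z)"
  by (subst dop_apply_superset[of "{\<mu>}"]) auto

lemma D_span_eq_D_submodule: "D_span s d X = D_submodule X"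
proof
  show "D_span s d X \<subseteq> D_submodule X"
  proof
    fix v assume "v \<in> D_span s d X"
    then obtain F P where F: "F \<subseteq> X" "v = (\<Sum>x\<in>F. dop_apply s d (P x) x)"
      unfolding D_span_def mem_Collect_eq by (elim exE conjE)
    have "dop_apply s d (P x) x \<in> D_submodule X" if "x \<in> F" for x
      unfolding D_submodule_def dop_apply_def
      using F(1) that by (intro span_sum span_scale span_base) blast
    then show "v \<in> D_submodule X"
      unfolding F(2) using subspace_D_submodule by (intro subspace_sum)
  qed
  have add: "u + v \<in> D_span s d X" if u: "u \<in> D_span s d X" and v: "v \<in> D_span s d X" for u v
  proof -
    obtain F P where F: "finite F" "F \<subseteq> X" "u = (\<Sum>x\<in>F. dop_apply s d (P x) x)"
      using u unfolding D_span_def mem_Collect_eq by (elim exE conjE)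
    obtain G Q where G: "finite G" "G \<subseteq> X" "v = (\<Sum>x\<in>G. dop_apply s d (Q x) x)"
      using v unfolding D_span_def mem_Collect_eq by (elim exE conjE)
    have "u = (\<Sum>x\<in>F \<union> G. dop_apply s d (if x \<in> F then P x else 0) x)"
      unfolding F(3) using F G by (intro sum.mono_neutral_cong_left) auto
    moreover have "v = (\<Sum>x\<in>F \<union> G. dop_apply s d (if x \<in> G then Q x else 0) x)"
      unfolding G(3) using F G by (intro sum.mono_neutral_cong_left) auto
    ultimately have "u + v = (\<Sum>x\<in>F \<union> G. dop_apply s d
        ((if x \<in> F then P x else 0) + (if x \<in> G then Q x else 0)) x)"
      by (simp only: dop_apply_add sum.distrib)
    with F G show ?thesis unfolding D_span_def mem_Collect_eq
      by (intro exI[of _ "F \<union> G"] exI conjI) auto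
  qed
  show "D_submodule X \<subseteq> D_span s d X"
  proof
    fix v assume "v \<in> D_submodule X"
    then show "v \<in> D_span s d X" unfolding D_submodule_def
    proof (induction rule: span_induct_alt)
      case base
      show ?case unfolding D_span_def by (auto intro!: exI[of _ "{}"])
    next
      case (step c z y)
      then obtain \<mu> x where z: "z = dpower d \<mu> x" "x \<in> X" by blast
      have "s c z = (\<Sum>x\<in>{x}. dop_apply s d (Poly_Mapping.single \<mu> c) x)"
        by (simp add: dop_apply_single z)
      then have "s c z \<in> D_span s d X"
        unfolding D_span_def mem_Collect_eq using z(2)
        by (intro exI[of _ "{x}"] exI[of _ "\<lambda>_. Poly_Mapping.single \<mu> c"]) simp
      with step show ?case by (intro add)
    qed
  qed
qed

end

section \<open>Completion of a solved involutive system\<close>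

text \<open>
  A free \<open>D\<close>-module on \<open>y\<close> with a first order system in solved form whose first
  prolongation is spanned by the equations and their multiplicative derivatives.
\<close>

locale solved_system = differential_module der s d
  for der :: "'n::{finite,linorder} \<Rightarrow> 'a::field_char_0 \<Rightarrow> 'a"
    and s :: "'a \<Rightarrow> 'v::ab_group_add \<Rightarrow> 'v"
    and d :: "'n \<Rightarrow> 'v \<Rightarrow> 'v" +
  fixes y :: "'m::finite \<Rightarrow> 'v"
    and S :: "'n \<Rightarrow> 'm set"
    and E :: "'n \<Rightarrow> 'm \<Rightarrow> 'v"
  assumes inj_jets: "inj (\<lambda>(k, \<mu>). dpower d \<mu> (y k))"
    and independent_jets: "independent (range (\<lambda>(k, \<mu>). dpower d \<mu> (y k)))"
    and solved: "k \<in> S i \<Longrightarrow> E i k - d i (y k) \<in>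
      span ({d i (y l) | l. l \<notin> S i} \<union> {d j (y l) | j l. j < i} \<union> range y)"
    and prolongation: "k \<in> S i \<Longrightarrow> d j (E i k) \<in>
      span ({E i' k' | i' k'. k' \<in> S i'} \<union> {d j' (E i' k') | i' j' k'. k' \<in> S i' \<and> j' \<le> i'})"
begin

definition Y :: "'m \<times> ('n \<Rightarrow> nat) \<Rightarrow> 'v" where
  "Y = (\<lambda>(k, \<mu>). dpower d \<mu> (y k))"

definition top_index :: "('n \<Rightarrow> nat) \<Rightarrow> 'n" where
  "top_index \<mu> = Max {i. \<mu> i \<noteq> 0}"

definition principal :: "'m \<times> ('n \<Rightarrow> nat) \<Rightarrow> bool" where
  "principal = (\<lambda>(k, \<mu>). \<mu> \<noteq> (\<lambda>_. 0) \<and> k \<in> S (top_index \<mu>))"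

text \<open>
  The candidate basis of \<open>Dy\<close>: a principal jet is replaced by the multiplicative prolongation that
  it leads. For \<open>\<mu>\<close> with largest index \<open>i\<close>, removing one derivative \<open>d\<^sub>i\<close> leaves only multiplicative
  variables of an equation of class \<open>i\<close>.
\<close>

definition adapted :: "'m \<times> ('n \<Rightarrow> nat) \<Rightarrow> 'v" where
  "adapted = (\<lambda>(k, \<mu>). if principal (k, \<mu>)
     then dpower d (\<mu>(top_index \<mu> := \<mu> (top_index \<mu>) - 1)) (E (top_index \<mu>) k)
     else dpower d \<mu> (y k))"

text \<open>
  An equation of class \<open>i\<close> may contain parametric jets of the same class and hence of the same
  weight as its leading jet. Ranking principal jets directly above parametric ones of equal weight
  makes the passage from jets to the candidate basis triangular.
\<close>

definition rank :: "'m \<times> ('n \<Rightarrow> nat) \<Rightarrow> nat" where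
  "rank z = 2 * mi_weight (snd z) + (if principal z then 1 else 0)"

abbreviation ord :: "'m \<times> ('n \<Rightarrow> nat) \<Rightarrow> nat" where
  "ord z \<equiv> mi_order (snd z)"

text \<open>
  Only multiplicative prolongations enter here. That they span the whole submodule generated by
  the equations is the content of \<open>dpower_E_in_J\<close> and \<open>J_subset\<close>.
\<close>

definition J :: "'v set" where
  "J = span (adapted ` Collect principal)"

lemma top_index_incr:
  assumes "\<And>j. i < j \<Longrightarrow> \<nu> j = 0"
  shows "top_index (incr i \<nu>) = i"
  unfolding top_index_def
proof (rule Max_eqI)
  fix j assume "j \<in> {j. incr i \<nu> j \<noteq> 0}"
  then have "\<not> i < j" using assms[of j] by (auto simp: incr_def split: if_splits)
  then show "j \<le> i" by simp
qed (simp_all add: incr_def)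

lemma incr_neq_zero [simp]: "incr i \<nu> \<noteq> (\<lambda>_. 0)"
proof
  assume "incr i \<nu> = (\<lambda>_. 0)"
  then have "incr i \<nu> i = 0" by simp
  then show False by (simp add: incr_def)
qed

lemma top_index_nonzero:
  assumes "\<mu> \<noteq> (\<lambda>_. 0)"
  shows "\<mu> (top_index \<mu>) \<noteq> 0" and "top_index \<mu> < j \<Longrightarrow> \<mu> j = 0"
proof -
  have "{i. \<mu> i \<noteq> 0} \<noteq> {}" using assms by auto
  then have "top_index \<mu> \<in> {i. \<mu> i \<noteq> 0}"
    unfolding top_index_def by (intro Max_in) auto
  then show "\<mu> (top_index \<mu>) \<noteq> 0" by simp
  show "top_index \<mu> < j \<Longrightarrow> \<mu> j = 0"
    unfolding top_index_def using Max_ge[of "{i. \<mu> i \<noteq> 0}" j] by fastforce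
qed

lemma principal_incr:
  assumes "\<And>j. i < j \<Longrightarrow> \<nu> j = 0"
  shows "principal (k, incr i \<nu>) \<longleftrightarrow> k \<in> S i"
  by (simp add: principal_def top_index_incr[OF assms])

lemma adapted_principal:
  assumes "k \<in> S i" "\<And>j. i < j \<Longrightarrow> \<nu> j = 0"
  shows "adapted (k, incr i \<nu>) = dpower d \<nu> (E i k)"
proof -
  have "(incr i \<nu>)(i := incr i \<nu> i - 1) = \<nu>" by (auto simp: incr_def)
  then show ?thesis
    using assms by (simp add: adapted_def top_index_incr principal_incr)
qed

lemma adapted_parametric: "\<not> principal z \<Longrightarrow> adapted z = Y z"
  by (auto simp: adapted_def Y_def split: prod.splits)

lemma principal_cases:
  assumes "principal z"
  obtains i k \<nu> where "z = (k, incr i \<nu>)" "k \<in> S i" "\<And>j. i < j \<Longrightarrow> \<nu> j = 0"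
    "adapted z = dpower d \<nu> (E i k)"
proof -
  obtain k \<mu> where z: "z = (k, \<mu>)" by (cases z)
  then have \<mu>: "\<mu> \<noteq> (\<lambda>_. 0)" and k: "k \<in> S (top_index \<mu>)" using assms by (auto simp: principal_def)
  let ?i = "top_index \<mu>" let ?\<nu> = "\<mu>(?i := \<mu> ?i - 1)"
  have e: "incr ?i ?\<nu> = \<mu>" using top_index_nonzero(1)[OF \<mu>] by (rule incr_decr)
  have v: "?\<nu> j = 0" if "?i < j" for j using top_index_nonzero(2)[OF \<mu> that] that by auto
  have z': "z = (k, incr ?i ?\<nu>)" by (simp only: e z)
  have bz: "adapted z = dpower d ?\<nu> (E ?i k)" unfolding z by (subst e[symmetric], rule adapted_principal[OF k v])
  show thesis by (rule that[OF z' k v bz])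
qed

lemma Y_incr: "d i (Y (k, \<mu>)) = Y (k, incr i \<mu>)"
  by (simp add: Y_def dpower_incr)

lemma dpower_y: "dpower d \<mu> (y k) = Y (k, \<mu>)"
  by (simp add: Y_def)

lemma dpower_d_y: "dpower d \<mu> (d i (y k)) = Y (k, incr i \<mu>)"
  by (simp add: Y_def dpower_incr dpower_d)

lemma adapted_minus_Y:
  "adapted z - Y z \<in> span (Y ` {x. rank x < rank z \<and> ord x \<le> ord z})"
proof (cases "principal z")
  case True
  then obtain i k \<nu> where z: "z = (k, incr i \<nu>)" and k: "k \<in> S i"
    and \<nu>: "\<And>j. i < j \<Longrightarrow> \<nu> j = 0" and bz: "adapted z = dpower d \<nu> (E i k)"
    by (rule principal_cases) blast
  let ?T = "{x. rank x < rank z \<and> ord x \<le> ord z}"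
  have rz: "rank z = 2 * mi_weight \<nu> + 2 * card {..i} + 1"
    using True z by (simp add: rank_def mi_weight_incr)
  have oz: "ord z = Suc (mi_order \<nu>)" using z by simp
  have lower: "x \<in> ?T" if "mi_weight (snd x) < mi_weight \<nu> + card {..i}" "ord x \<le> Suc (mi_order \<nu>)" for x
    using that rz oz by (simp add: rank_def)
  have "adapted z - Y z = dpower d \<nu> (E i k - d i (y k))"
    by (simp only: bz dpower_diff dpower_d_y) (simp only: z)
  also have "\<dots> \<in> span (Y ` ?T)"
  proof (rule dpower_in_span[OF solved[OF k]])
    fix x \<mu> assume x: "x \<in> {d i (y l) | l. l \<notin> S i} \<union> {d j (y l) | j l. j < i} \<union> range y"
      and \<mu>: "\<mu> \<le> \<nu>"
    have w: "mi_weight \<mu> \<le> mi_weight \<nu>" and o: "mi_order \<mu> \<le> mi_order \<nu>"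
      using \<mu> by (rule mi_weight_mono, rule mi_order_mono)
    consider (same) l where "x = d i (y l)" "l \<notin> S i" | (less) j l where "x = d j (y l)" "j < i"
      | (zero) l where "x = y l"
      using x by blast
    then show "dpower d \<mu> x \<in> span (Y ` ?T)"
    proof cases
      case same
      have "(l, incr i \<mu>) \<in> ?T"
      proof (cases "\<mu> = \<nu>")
        case True
        have "\<not> principal (l, incr i \<nu>)" using principal_incr[OF \<nu>] same(2) by simp
        then show ?thesis using rz oz True by (simp add: rank_def mi_weight_incr)
      next
        case False
        then show ?thesis
          using mi_weight_strict_mono[OF \<mu>] o by (intro lower) (simp_all add: mi_weight_incr)
      qed
      then show ?thesis by (simp add: same dpower_d_y span_imageI)
    next
      case less
      have "(l, incr j \<mu>) \<in> ?T"
        using card_atMost_less[OF less(2)] w o by (intro lower) (simp_all add: mi_weight_incr)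
      then show ?thesis by (simp add: less dpower_d_y span_imageI)
    next
      case zero
      have "(l, \<mu>) \<in> ?T"
        using card_atMost_pos[of i] w o by (intro lower) simp_all
      then show ?thesis by (simp add: zero dpower_y span_imageI)
    qed
  qed
  finally show ?thesis .
qed (simp add: adapted_parametric span_zero)

lemma Y_in_span_adapted: "Y z \<in> span (adapted ` {x. rank x \<le> rank z \<and> ord x \<le> ord z})"
proof (induction "rank z" arbitrary: z rule: less_induct)
  case less
  let ?T = "adapted ` {x. rank x \<le> rank z \<and> ord x \<le> ord z}"
  have "Y x \<in> span ?T" if "rank x < rank z" "ord x \<le> ord z" for x
    using less[OF that(1)] by (rule span_mono[THEN subsetD, rotated]) (use that in auto)
  then have "span (Y ` {x. rank x < rank z \<and> ord x \<le> ord z}) \<subseteq> span ?T"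
    by (intro span_minimal) auto
  then have "adapted z - Y z \<in> span ?T" using adapted_minus_Y by blast
  moreover have "adapted z \<in> span ?T" by (intro span_imageI) simp
  ultimately have "adapted z - (adapted z - Y z) \<in> span ?T" by (rule span_diff[rotated])
  then show ?case by simp
qed

lemma Y_in_span_adapted_ord: "ord z \<le> q \<Longrightarrow> Y z \<in> span (adapted ` {x. ord x \<le> q})"
  by (rule span_mono[THEN subsetD, OF _ Y_in_span_adapted]) auto

lemma Y_in_span_adapted_weight:
  "Y z \<in> span (adapted ` {x. mi_weight (snd x) \<le> mi_weight (snd z)})"
  by (rule span_mono[THEN subsetD, OF _ Y_in_span_adapted]) (auto simp: rank_def split: if_splits)

text \<open>
  Triangularity gives that the jets of order at most \<open>q\<close> are combinations of equally many
  candidate basis elements, which is enough for independence.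
\<close>

lemma inj_independent_adapted_ord: "inj_on adapted {x. ord x \<le> q} \<and> independent (adapted ` {x. ord x \<le> q})"
proof (rule independent_family_exchange)
  show "inj_on Y {x. ord x \<le> q}" using inj_jets inj_on_subset Y_def by fastforce
  show "independent (Y ` {x. ord x \<le> q})"
    by (rule independent_mono[OF independent_jets]) (auto simp: Y_def)
  show "Y ` {x. ord x \<le> q} \<subseteq> span (adapted ` {x. ord x \<le> q})"
    using Y_in_span_adapted_ord by blast
qed (rule finite_jet_index)

lemma inj_adapted: "inj adapted" and independent_adapted: "independent (range adapted)"
  using independent_family_filtration[of adapted ord, OF inj_independent_adapted_ord] by blast+

lemma adapted_notin_span: "x \<notin> A \<Longrightarrow> adapted x \<notin> span (adapted ` A)"
proof
  assume x: "x \<notin> A" and "adapted x \<in> span (adapted ` A)"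
  moreover have "adapted x \<in> span (adapted ` {x})" by (intro span_imageI) simp
  ultimately have "adapted x \<in> span (adapted ` A \<inter> adapted ` {x})"
    by (intro span_inter_of_independent[OF independent_adapted]) auto
  also have "adapted ` A \<inter> adapted ` {x} = {}" using x inj_adapted by (auto dest: injD)
  finally have "adapted x = 0" by simp
  then show False using independent_adapted dependent_zero by (metis rangeI)
qed

text \<open>
  A non-multiplicative derivative can be rewritten using derivatives with respect to strictly
  earlier variables only. Indeed \<open>d\<^sub>jE\<close> is a combination of multiplicative prolongations by
  involution, and, by its weight, also of basis elements not heavier than \<open>d\<^sub>jd\<^sub>iy\<close>. By independence
  the prolongations that really occur, with leading jets \<open>d\<^sub>a d\<^sub>c y\<close> and \<open>a \<le> c\<close>, are not heavier either;
  \<open>j \<le> a \<le> c\<close> would make them heavier, as \<open>i < j\<close>.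
\<close>

lemma prolongation_reduced:
  assumes k: "k \<in> S i" and ij: "i < j"
  shows "d j (E i k) \<in>
    span ({E i' k' | i' k'. k' \<in> S i'} \<union> {d j' (E i' k') | i' j' k'. k' \<in> S i' \<and> j' < j})"
proof -
  let ?one = "\<lambda>i. incr i (\<lambda>_. 0)"
  let ?R = "{E i' k' | i' k'. k' \<in> S i'} \<union> {d j' (E i' k') | i' j' k'. k' \<in> S i' \<and> j' < j}"
  let ?P = "{(k', ?one i') | i' k'. k' \<in> S i'} \<union>
            {(k', incr i' (?one j')) | i' j' k'. k' \<in> S i' \<and> j' \<le> i'}"
  let ?Q = "{x :: 'm \<times> ('n \<Rightarrow> nat). mi_weight (snd x) \<le> card {..i} + card {..j}}"
  have b1: "adapted (k', ?one i') = E i' k'" if "k' \<in> S i'" for i' k'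
    by (subst adapted_principal[OF that]) auto
  have b2: "adapted (k', incr i' (?one j')) = d j' (E i' k')" if "k' \<in> S i'" "j' \<le> i'" for i' j' k'
  proof -
    have "?one j' j = 0" if "i' < j" for j using that \<open>j' \<le> i'\<close> by (auto simp: incr_def)
    then show ?thesis using adapted_principal[OF that(1), of "?one j'"] by (simp add: dpower_incr)
  qed
  have "d j (E i k) \<in> span (adapted ` ?P)"
  proof (rule span_mono[THEN subsetD, OF _ prolongation[OF k]], safe)
    fix i' k' assume "k' \<in> S i'"
    then show "E i' k' \<in> adapted ` ?P" by (intro image_eqI[of _ adapted "(k', ?one i')"]) (auto simp: b1)
  next
    fix i' j' k' assume "k' \<in> S i'" "j' \<le> i'"
    then show "d j' (E i' k') \<in> adapted ` ?P"
      by (intro image_eqI[of _ adapted "(k', incr i' (?one j'))"]) (auto simp: b2)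
  qed
  moreover have "d j (E i k) \<in> span (adapted ` ?Q)"
  proof -
    let ?X = "{d i (y l) | l. l \<notin> S i} \<union> {d j (y l) | j l. j < i} \<union> range y"
    let ?Z = "{d a (y l) | a l. a \<le> i} \<union> range y"
    have "E i k - d i (y k) \<in> span ?Z"
      by (rule span_mono[THEN subsetD, OF _ solved[OF k]]) auto
    moreover have "d i (y k) \<in> span ?Z" by (intro span_base) auto
    ultimately have "(E i k - d i (y k)) + d i (y k) \<in> span ?Z" by (rule span_add)
    then have E: "E i k \<in> span ?Z" by simp
    have w: "Y z \<in> span (adapted ` ?Q)" if "mi_weight (snd z) \<le> card {..i} + card {..j}" for z
      by (rule span_mono[THEN subsetD, OF _ Y_in_span_adapted_weight]) (use that in auto)
    have w0: "mi_weight (\<lambda>_. 0) = 0" by (simp add: mi_weight_def)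
    have Y0: "y l = Y (l, \<lambda>_. 0)" for l by (simp add: Y_def)
    have le: "card {..a} \<le> card {..i}" if "a \<le> i" for a
      using that by (intro card_mono) auto
    have mem: "x \<in> span (adapted ` ?Q) \<and> d j x \<in> span (adapted ` ?Q)" if x: "x \<in> ?Z" for x
    proof -
      consider a l where "x = d a (y l)" "a \<le> i" | l where "x = y l" using x by blast
      then show ?thesis
        by cases (auto simp: Y0 Y_incr mi_weight_incr w0 intro!: w dest!: le)
    qed
    show ?thesis by (rule d_in_span[OF E]) (use mem in blast)+
  qed
  ultimately have "d j (E i k) \<in> span (adapted ` ?P \<inter> adapted ` ?Q)"
    by (intro span_inter_of_independent[OF independent_adapted]) auto
  moreover have "adapted ` ?P \<inter> adapted ` ?Q \<subseteq> ?R"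
  proof
    fix v assume v: "v \<in> adapted ` ?P \<inter> adapted ` ?Q"
    then obtain x where x: "x \<in> ?P" "v = adapted x" by blast
    obtain x' where x': "x' \<in> ?Q" "v = adapted x'" using v by blast
    have "x = x'" using x(2) x'(2) injD[OF inj_adapted] by simp
    then have xQ: "x \<in> ?Q" using x'(1) by simp
    from x(1) consider (one) i' k' where "x = (k', ?one i')" "k' \<in> S i'"
      | (two) i' j' k' where "x = (k', incr i' (?one j'))" "k' \<in> S i'" "j' \<le> i'" by blast
    then show "v \<in> ?R"
    proof cases
      case one
      then show ?thesis using b1 x(2) by blast
    next
      case two
      have "j' < j"
      proof (rule ccontr)
        assume "\<not> j' < j"
        then have "card {..j} \<le> card {..j'}" "card {..j} \<le> card {..i'}"
          using two(3) by (auto intro!: card_mono)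
        moreover have "card {..i} < card {..j}" using ij by (rule card_atMost_less)
        moreover have "card {..i'} + card {..j'} \<le> card {..i} + card {..j}"
          using xQ by (simp add: two(1) mi_weight_incr mi_weight_def[of "\<lambda>_. 0"])
        ultimately show False by linarith
      qed
      then show ?thesis using b2 two x(2) by blast
    qed
  qed
  ultimately show ?thesis by (rule span_mono[THEN subsetD, rotated])
qed

text \<open>
  Formal integrability: the criterion on the first prolongation propagates to all orders. One
  non-multiplicative derivative \<open>d\<^sub>j\<close> in \<open>\<nu>\<close> is traded for an earlier one or for none by
  \<open>prolongation_reduced\<close>, which lowers the weight of the operator although the equations involved
  change; hence the induction is on the weight of \<open>\<nu>\<close> for all equations at once.
\<close>

lemma dpower_E_in_J: "k \<in> S i \<Longrightarrow> dpower d \<nu> (E i k) \<in> J"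
proof (induction "mi_weight \<nu>" arbitrary: \<nu> i k rule: less_induct)
  case less
  show ?case
  proof (cases "\<forall>j>i. \<nu> j = 0")
    case True
    then have "principal (k, incr i \<nu>)" and eq: "adapted (k, incr i \<nu>) = dpower d \<nu> (E i k)"
      using principal_incr[of i \<nu> k] adapted_principal[of k i \<nu>] less.prems by simp_all
    then show ?thesis unfolding J_def eq[symmetric] by (intro span_imageI) simp
  next
    case False
    then obtain j where ij: "i < j" and "\<nu> j \<noteq> 0" by blast
    define \<nu>' where "\<nu>' = \<nu>(j := \<nu> j - 1)"
    have \<nu>: "\<nu> = incr j \<nu>'" unfolding \<nu>'_def using \<open>\<nu> j \<noteq> 0\<close> by (rule incr_decr[symmetric])
    have "dpower d \<nu> (E i k) = dpower d \<nu>' (d j (E i k))"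
      by (simp add: \<nu> dpower_incr dpower_d)
    also have "\<dots> \<in> J" unfolding J_def
    proof (rule dpower_in_span[OF prolongation_reduced[OF less.prems ij]])
      fix x \<mu>
      assume x: "x \<in> {E i' k' | i' k'. k' \<in> S i'} \<union> {d j' (E i' k') | i' j' k'. k' \<in> S i' \<and> j' < j}"
        and "\<mu> \<le> \<nu>'"
      then have w: "mi_weight \<mu> \<le> mi_weight \<nu>'" by (intro mi_weight_mono)
      from x consider (one) i' k' where "x = E i' k'" "k' \<in> S i'"
        | (two) i' j' k' where "x = d j' (E i' k')" "k' \<in> S i'" "j' < j" by blast
      then show "dpower d \<mu> x \<in> span (adapted ` Collect principal)"
      proof cases
        case one
        have "mi_weight \<mu> < mi_weight \<nu>" using w card_atMost_pos[of j] by (simp add: \<nu> mi_weight_incr)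
        from less.hyps[OF this one(2)] show ?thesis by (simp add: one(1) J_def)
      next
        case two
        have "mi_weight (incr j' \<mu>) < mi_weight \<nu>"
          using w card_atMost_less[OF two(3)] by (simp add: \<nu> mi_weight_incr)
        from less.hyps[OF this two(2)] show ?thesis
          by (simp add: two(1) J_def dpower_incr dpower_d)
      qed
    qed
    finally show ?thesis .
  qed
qed

lemma E_in_J: "k \<in> S i \<Longrightarrow> E i k \<in> J"
  using dpower_E_in_J[of k i "\<lambda>_. 0"] by simp

lemma d_in_J: "u \<in> J \<Longrightarrow> d i u \<in> J"
proof -
  assume u: "u \<in> J"
  show "d i u \<in> J" unfolding J_def
  proof (rule d_in_span[OF u[unfolded J_def]])
    fix v assume "v \<in> adapted ` Collect principal"
    then obtain j k \<nu> where "v = dpower d \<nu> (E j k)" "k \<in> S j"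
      by (auto elim!: principal_cases)
    then show "d i v \<in> span (adapted ` Collect principal)"
      using dpower_E_in_J[of k j "incr i \<nu>"] by (simp add: J_def dpower_incr)
  qed (rule span_base)
qed

lemma J_subset:
  assumes "subspace V" "\<And>i v. v \<in> V \<Longrightarrow> d i v \<in> V" "\<And>i k. k \<in> S i \<Longrightarrow> E i k \<in> V"
  shows "J \<subseteq> V"
proof -
  have "dpower d \<nu> (E i k) \<in> V" if "k \<in> S i" for \<nu> i k
    by (induction \<nu> rule: multi_index_induct) (use assms that in \<open>auto simp: dpower_incr\<close>)
  then show ?thesis unfolding J_def using assms(1)
    by (intro span_minimal) (auto elim!: principal_cases)
qed

end

section \<open>A sparse set of jets\<close>

lemma lacunary_powers:
  fixes p p' q N N' :: nat
  assumes "p \<le> q" "p' \<le> q" "Suc q \<le> N" "p' + 2 ^ N = 2 ^ N' + p"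
  shows "N' = N"
proof (rule ccontr)
  assume "N' \<noteq> N"
  have "q < 2 ^ q" by simp
  moreover have "(2::nat) ^ Suc q \<le> 2 ^ N" using assms(3) by (intro power_increasing) auto
  ultimately have q: "2 * q < 2 ^ N" unfolding power_Suc by linarith
  show False
  proof (cases "N' < N")
    case True
    then have "(2::nat) ^ Suc N' \<le> 2 ^ N" by (intro power_increasing) auto
    then show False using assms(1,4) q by simp
  next
    case False
    with \<open>N' \<noteq> N\<close> have "(2::nat) ^ Suc N \<le> 2 ^ N'" by (intro power_increasing) auto
    then show False using assms(2,4) q by simp
  qed
qed

text \<open>
  A multi-index is a position \<open>\<mu>\<^sub>i\<close> on the ray given by the remaining data. The marked
  positions on all rays together are distinct powers of 2, each ray owning the exponents that the
  pairing function assigns to its code. A power of 2 beyond \<open>2\<^sup>q\<close> is more than \<open>q\<close> away from all others, so a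
  shift to it that moves one index of order at most \<open>q\<close> to a marked position fits no other such index: on the
  same ray the positions differ, and on another ray the power belongs to someone else.
\<close>

lemma sparse_indices_exist:
  fixes i :: "'n::finite"
  obtains \<phi> :: "'m::finite \<times> ('n \<Rightarrow> nat) \<Rightarrow> bool"
  where "\<And>k \<mu>. \<phi> (k, \<mu>) \<Longrightarrow> \<mu> i \<noteq> 0"
    and "\<And>q k \<mu>. mi_order \<mu> \<le> q \<Longrightarrow>
      \<exists>r>0. \<forall>l \<nu>. mi_order \<nu> \<le> q \<longrightarrow> \<phi> (l, \<nu>(i := \<nu> i + r)) \<longleftrightarrow> (l, \<nu>) = (k, \<mu>)"
proof -
  let ?c = "\<lambda>k \<mu>. to_nat (k :: 'm, \<mu>(i := 0) :: 'n \<Rightarrow> nat)"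
  define \<phi> where "\<phi> = (\<lambda>(k, \<mu>). \<exists>t. \<mu> i = 2 ^ prod_encode (?c k \<mu>, t))"
  show thesis
  proof (rule that[of \<phi>])
    show "\<mu> i \<noteq> 0" if "\<phi> (k, \<mu>)" for k \<mu>
      using that by (auto simp: \<phi>_def)
  next
    fix q and k :: 'm and \<mu> :: "'n \<Rightarrow> nat" assume q: "mi_order \<mu> \<le> q"
    (* the second component q + 1 serves only to make the exponent exceed q *)
    define N where "N = prod_encode (?c k \<mu>, Suc q)"
    have N: "Suc q \<le> N" unfolding N_def by (rule le_prod_encode_2)
    then have qN: "q < 2 ^ N" using less_exp[of N] by linarith
    have le: "\<nu> i \<le> q" if "mi_order \<nu> \<le> q" for \<nu> :: "'n \<Rightarrow> nat"
      using le_mi_order that by (rule le_trans)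
    have r: "\<mu> i + (2 ^ N - \<mu> i) = 2 ^ N" using le[OF q] qN by simp
    have "\<phi> (l, \<nu>(i := \<nu> i + (2 ^ N - \<mu> i))) \<longleftrightarrow> (l, \<nu>) = (k, \<mu>)" if \<nu>: "mi_order \<nu> \<le> q" for l \<nu>
    proof
      assume "\<phi> (l, \<nu>(i := \<nu> i + (2 ^ N - \<mu> i)))"
      then obtain t where "\<nu> i + (2 ^ N - \<mu> i) = 2 ^ prod_encode (?c l \<nu>, t)"
        by (auto simp: \<phi>_def)
      then have eq: "\<nu> i + 2 ^ N = 2 ^ prod_encode (?c l \<nu>, t) + \<mu> i" using r by linarith
      have "prod_encode (?c l \<nu>, t) = N"
        by (rule lacunary_powers[OF le[OF q] le[OF \<nu>] N eq])
      then have "?c l \<nu> = ?c k \<mu>" and "\<nu> i = \<mu> i"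
        using eq by (simp_all add: N_def)
      then have "l = k" and "\<nu>(i := 0) = \<mu>(i := 0)" by simp_all
      moreover have "\<nu> = \<mu>"
        using \<open>\<nu> i = \<mu> i\<close> \<open>\<nu>(i := 0) = \<mu>(i := 0)\<close> by (metis fun_upd_triv fun_upd_upd)
      ultimately show "(l, \<nu>) = (k, \<mu>)" by simp
    next
      assume "(l, \<nu>) = (k, \<mu>)"
      then show "\<phi> (l, \<nu>(i := \<nu> i + (2 ^ N - \<mu> i)))"
        using r by (auto simp: \<phi>_def N_def)
    qed
    then show "\<exists>r>0. \<forall>l \<nu>. mi_order \<nu> \<le> q \<longrightarrow> \<phi> (l, \<nu>(i := \<nu> i + r)) \<longleftrightarrow> (l, \<nu>) = (k, \<mu>)"
      using le[OF q] qN by (intro exI[of _ "2 ^ N - \<mu> i"]) auto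
  qed
qed

section \<open>Sections\<close>

context differential_module
begin

text \<open>In contrast to \<open>spencer\<close>, this also covers the derivations of the new variables.\<close>

definition spencer_op :: "'n \<Rightarrow> ('v \<Rightarrow> 'a) \<Rightarrow> 'v \<Rightarrow> 'a" where
  "spencer_op i f = (\<lambda>u. der i (f u) - f (d i u))"

lemma spencer_op_apply: "spencer_op i f u = der i (f u) - f (d i u)"
  by (simp add: spencer_op_def)

lemma linear_functional_iff:
  "Vector_Spaces.linear s (*) f \<longleftrightarrow> (\<forall>u v. f (u + v) = f u + f v) \<and> (\<forall>a u. f (s a u) = a * f u)"
  by (simp add: Vector_Spaces.linear_iff vector_space_axioms vector_space_over_itself.vector_space_axioms)

lemma linear_spencer_op:
  "Vector_Spaces.linear s (*) f \<Longrightarrow> Vector_Spaces.linear s (*) (spencer_op i f)"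
  unfolding linear_functional_iff
  by (simp add: spencer_op_apply d_add d_scale der_add der_mult algebra_simps)

lemma der_sign: "c \<in> {0, 1} \<Longrightarrow> der i ((-1) ^ r * c) = 0"
proof -
  assume c: "c \<in> {0, 1}"
  have "der i (-1) = 0" using der_add[of i 1 "-1"] by simp
  then have "der i ((-1) ^ r) = 0" by (induction r) (simp_all only: power_0 power_Suc der_one der_mult mult_zero_left mult_zero_right add_0)
  with c show ?thesis by (auto simp: der_mult)
qed

text \<open>
  In \<open>(d\<^sub>i f)(u) = \<partial>\<^sub>i(f(u)) - f(d\<^sub>i u)\<close> the first term vanishes along the whole orbit of \<open>u\<close>, because 0
  and 1 are constants. Choosing such values is what keeps the derivations of \<open>K\<close>, about which
  nothing is known, out of the argument.
\<close>

lemma spencer_op_power_constants: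
  assumes "\<And>t. f ((d i ^^ t) u) \<in> {0, 1}"
  shows "(spencer_op i ^^ r) f u = (-1) ^ r * f ((d i ^^ r) u)"
  using assms
proof (induction r arbitrary: u)
  case (Suc r)
  have "f ((d i ^^ t) (d i u)) \<in> {0, 1}" for t
    using Suc.prems[of "Suc t"] by (simp add: funpow_swap1)
  then have "(spencer_op i ^^ r) f (d i u) = (-1) ^ r * f ((d i ^^ r) (d i u))"
    by (rule Suc.IH)
  moreover have "(spencer_op i ^^ r) f u = (-1) ^ r * f ((d i ^^ r) u)"
    using Suc.prems by (rule Suc.IH)
  ultimately have "(spencer_op i ^^ Suc r) f u = - ((-1) ^ r * f ((d i ^^ r) (d i u)))"
    using der_sign[OF Suc.prems] by (simp add: spencer_op_apply)
  then show ?case by (simp add: funpow_swap1)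
qed simp

end

context solved_system
begin

definition first :: 'n where "first = Min UNIV"

text \<open>
  Parametric jets all of whose derivatives with respect to the first variable are parametric.
\<close>

definition movable :: "'m \<times> ('n \<Rightarrow> nat) \<Rightarrow> bool" where
  "movable z \<longleftrightarrow> \<not> principal z \<and> (snd z \<noteq> (\<lambda>_. 0) \<or> fst z \<notin> S first)"

lemma first_le: "first \<le> i"
  by (simp add: first_def)

lemma not_principal_zero: "\<not> principal (k, \<lambda>_. 0)"
  by (simp add: principal_def)

text \<open>
  A derivative with respect to the first variable leaves the largest index of a nonzero
  multi-index unchanged, and with it the decision whether the jet is principal.
\<close>

lemma movable_incr:
  assumes "movable (k, \<mu>)"
  shows "movable (k, incr first \<mu>)" and "adapted (k, incr first \<mu>) = d first (adapted (k, \<mu>))"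
proof -
  have np: "\<not> principal (k, incr first \<mu>)"
  proof (cases "\<mu> = (\<lambda>_. 0)")
    case True
    then show ?thesis using assms principal_incr[of first \<mu> k] by (simp add: movable_def)
  next
    case False
    let ?t = "top_index \<mu>"
    have "top_index (incr first \<mu>) = ?t"
      unfolding top_index_def[of "incr first \<mu>"]
    proof (rule Max_eqI)
      fix j assume "j \<in> {j. incr first \<mu> j \<noteq> 0}"
      then consider "j = first" | "\<mu> j \<noteq> 0" by (auto simp: incr_def split: if_splits)
      then show "j \<le> ?t"
      proof cases
        case 1
        then show ?thesis using first_le by simp
      next
        case 2
        then show ?thesis using top_index_nonzero(2)[OF False, of j] by (cases "j \<le> ?t") simp_all
      qed
    qed (use top_index_nonzero(1)[OF False] in \<open>auto simp: incr_def\<close>)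
    then show ?thesis using assms False by (simp add: movable_def principal_def)
  qed
  then show "movable (k, incr first \<mu>)" by (simp add: movable_def)
  have "adapted (k, \<mu>) = Y (k, \<mu>)" using assms by (simp add: movable_def adapted_parametric)
  then show "adapted (k, incr first \<mu>) = d first (adapted (k, \<mu>))"
    using np by (simp add: adapted_parametric Y_incr)
qed

lemma movable_shift:
  assumes "movable (k, \<mu>)"
  shows "movable (k, \<mu>(first := \<mu> first + r)) \<and>
    (d first ^^ r) (adapted (k, \<mu>)) = adapted (k, \<mu>(first := \<mu> first + r))"
proof (induction r)
  case (Suc r)
  let ?\<mu> = "\<lambda>r. \<mu>(first := \<mu> first + r)"
  have m: "movable (k, ?\<mu> r)" and e: "(d first ^^ r) (adapted (k, \<mu>)) = adapted (k, ?\<mu> r)"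
    using Suc by blast+
  have "incr first (?\<mu> r) = ?\<mu> (Suc r)" by (auto simp: incr_def)
  with movable_incr[OF m] show ?case by (simp only: funpow.simps o_apply e simp_thms)
qed (use assms in simp)

text \<open>
  If every \<open>d\<^sub>1y\<^sup>k\<close> is expressed by jets of order 0, then \<open>d\<^sub>jd\<^sub>1y\<^sup>k\<close> is expressed modulo the equations
  by jets of order at most 1. For \<open>k\<close> not principal in class \<open>j\<close>, however, this jet
  is a parametric one of order 2, contradicting independence.
\<close>

lemma positive_order_principal:
  assumes S: "S first = UNIV" and \<mu>: "\<mu> \<noteq> (\<lambda>_. 0)"
  shows "principal (k, \<mu>)"
proof (rule ccontr)
  assume np: "\<not> principal (k, \<mu>)"
  define j where "j = top_index \<mu>"
  have kj: "k \<notin> S j" using np \<mu> by (simp add: principal_def j_def)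
  then have "first \<noteq> j" using S by auto
  then have less: "first < j" using first_le[of j] by order
  (* the jet d_j d_1 y^k, parametric of order 2 *)
  define x where "x = (k, incr j (incr first (\<lambda>_. 0)))"
  have "\<not> principal x"
    unfolding x_def using kj less by (subst principal_incr) (auto simp: incr_def)
  let ?A = "Collect principal \<union> {z. ord z \<le> 1}"
  have Ey: "E first k - d first (y k) \<in> span (range y)"
  proof -
    have eq: "{d first (y l) | l. l \<notin> S first} \<union> {d j (y l) | j l. j < first} \<union> range y = range y"
      using S first_le leD by blast
    have "k \<in> S first" using S by simp
    then show ?thesis using solved[of k first] unfolding eq by blast
  qed
  have yA: "y l \<in> span (adapted ` ?A) \<and> d j (y l) \<in> span (adapted ` ?A)" for l
  proof -
    have "Y z \<in> span (adapted ` ?A)" if "ord z \<le> 1" for z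
      by (rule span_mono[THEN subsetD, OF _ Y_in_span_adapted_ord[OF that]]) auto
    from this[of "(l, \<lambda>_. 0)"] this[of "(l, incr j (\<lambda>_. 0))"] show ?thesis
      by (simp add: Y_def dpower_incr)
  qed
  have "d j (E first k - d first (y k)) \<in> span (adapted ` ?A)"
    by (rule d_in_span[OF Ey]) (use yA in blast)+
  moreover have "d j (E first k) \<in> span (adapted ` ?A)"
  proof -
    have "k \<in> S first" using S by simp
    then have "d j (E first k) \<in> J" by (intro d_in_J E_in_J)
    then show ?thesis unfolding J_def by (rule span_mono[THEN subsetD, rotated]) auto
  qed
  ultimately have "d j (E first k) - d j (E first k - d first (y k)) \<in> span (adapted ` ?A)"
    by (rule span_diff[rotated])
  then have "adapted x \<in> span (adapted ` ?A)"
    using \<open>\<not> principal x\<close> by (simp add: adapted_parametric d_diff x_def Y_def dpower_incr)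
  moreover have "x \<notin> ?A" using \<open>\<not> principal x\<close> by (simp add: x_def)
  ultimately show False using adapted_notin_span[of x ?A] by simp
qed

text \<open>The linear forms on \<open>M\<close>, that is, the sections.\<close>

definition functional :: "('v \<Rightarrow> 'a) \<Rightarrow> bool" where
  "functional f \<longleftrightarrow> Vector_Spaces.linear s (*) f \<and> (\<forall>u\<in>J. f u = 0)"

lemma functional_spencer_op: "functional f \<Longrightarrow> functional (spencer_op i f)"
  unfolding functional_def by (auto intro: linear_spencer_op simp: spencer_op_apply d_in_J)

lemma functional_spencer_op_power: "functional f \<Longrightarrow> functional ((spencer_op i ^^ r) f)"
  by (induction r) (auto intro: functional_spencer_op)

lemma functional_eq_on_jets:
  assumes f: "functional f" and g: "functional g"
    and eq: "\<And>z. \<not> principal z \<Longrightarrow> ord z \<le> q \<Longrightarrow> f (adapted z) = g (adapted z)"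
    and u: "u \<in> span (Y ` {z. ord z \<le> q})"
  shows "f u = g u"
proof -
  interpret vector_space_pair s "(*) :: 'a \<Rightarrow> 'a \<Rightarrow> 'a" by unfold_locales
  have "f v = g v" if v: "v \<in> adapted ` {x. ord x \<le> q}" for v
  proof -
    from v obtain x where x: "v = adapted x" "ord x \<le> q" by blast
    show ?thesis
    proof (cases "principal x")
      case True
      then have "adapted x \<in> J" unfolding J_def by (intro span_imageI) simp
      then show ?thesis using f g x by (simp add: functional_def)
    qed (use eq x in simp)
  qed
  moreover have "span (Y ` {z. ord z \<le> q}) \<subseteq> span (adapted ` {x. ord x \<le> q})"
    using Y_in_span_adapted_ord by (intro span_minimal) auto
  ultimately show ?thesis
    using linear_eq_on[of f g u "adapted ` {x. ord x \<le> q}"] f g u by (auto simp: functional_def)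
qed

text \<open>
  Prescribe 0 on the prolongations that complete the parametric jets to an independent family, and
  extend linearly.
\<close>

lemma functional_with_values:
  obtains f where "functional f" "\<And>z. \<not> principal z \<Longrightarrow> f (adapted z) = c z"
proof -
  interpret vector_space_pair s "(*) :: 'a \<Rightarrow> 'a \<Rightarrow> 'a" by unfold_locales
  define f where "f = construct (range adapted) (\<lambda>v. if principal (inv adapted v) then 0 else c (inv adapted v))"
  have lin: "Vector_Spaces.linear s (*) f"
    unfolding f_def by (rule linear_construct[OF independent_adapted])
  have fb: "f (adapted z) = (if principal z then 0 else c z)" for z
    unfolding f_def by (subst construct_basis[OF independent_adapted]) (simp_all add: inj_adapted)
  have "f u = 0" if "u \<in> J" for u
    using that unfolding J_def
  proof (induction rule: span_induct_alt)
    case base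
    show ?case using lin unfolding linear_functional_iff by (metis add_cancel_right_left)
  next
    case (step a x v)
    then have "f x = 0" by (auto simp: fb)
    with step lin show ?case by (simp add: linear_functional_iff)
  qed
  then have "functional f" using lin by (simp add: functional_def)
  then show thesis using that fb by simp
qed

lemma functional_combination:
  fixes G :: "'x \<Rightarrow> 'v \<Rightarrow> 'a" and H :: "'z \<Rightarrow> 'v \<Rightarrow> 'a"
  assumes "\<And>x. functional (G x)" "\<And>x. functional (H x)"
  shows "functional (\<lambda>u. (\<Sum>x\<in>X. a x * G x u) + (\<Sum>x\<in>Z. c x * H x u))"
proof -
  have G: "G x (u + v) = G x u + G x v" "G x (s e u) = e * G x u" "w \<in> J \<Longrightarrow> G x w = 0" for x u v e w
    using assms(1)[of x] by (simp_all add: functional_def linear_functional_iff)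
  have H: "H x (u + v) = H x u + H x v" "H x (s e u) = e * H x u" "w \<in> J \<Longrightarrow> H x w = 0" for x u v e w
    using assms(2)[of x] by (simp_all add: functional_def linear_functional_iff)
  show ?thesis
    by (simp add: functional_def linear_functional_iff G H distrib_left sum.distrib
        sum_distrib_left mult.left_commute)
qed

text \<open>
  The section \<open>g\<^sub>k\<close> is dual to \<open>y\<^sup>k\<close> and zero on the other parametric jets, except that the section of
  one unknown \<open>k0\<close> carries the sparse values in addition. Its iterated derivatives reach all
  movable jets, but they may take uncontrolled values on the unknowns that are not movable, where
  their derivatives are not parametric. The sections of these unknowns correct this; they
  vanish on movable jets, as \<open>k0\<close> is not among them unless there are no movable jets.
\<close>

lemma generating_functionals:
  obtains g :: "'m \<Rightarrow> 'v \<Rightarrow> 'a" and k0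
  where "\<And>k. functional (g k)"
    and "\<And>k l. g k (y l) = (if k = l then 1 else 0)"
    and "\<And>f q. functional f \<Longrightarrow> \<exists>(X :: ('m \<times> ('n \<Rightarrow> nat)) set) a r c. \<forall>u\<in>span (Y ` {z. ord z \<le> q}).
      f u = (\<Sum>x\<in>X. a x * (spencer_op first ^^ r x) (g k0) u) + (\<Sum>l\<in>UNIV. c l * g l u)"
proof -
  obtain \<phi> :: "'m \<times> ('n \<Rightarrow> nat) \<Rightarrow> bool"
    where \<phi>0: "\<And>k \<mu>. \<phi> (k, \<mu>) \<Longrightarrow> \<mu> first \<noteq> 0"
    and \<phi>: "\<And>q k \<mu>. mi_order \<mu> \<le> q \<Longrightarrow> \<exists>r>0. \<forall>l \<nu>. mi_order \<nu> \<le> q \<longrightarrow>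
      \<phi> (l, \<nu>(first := \<nu> first + r)) \<longleftrightarrow> (l, \<nu>) = (k, \<mu>)"
    by (rule sparse_indices_exist[of first]) blast
  obtain k0 where k0: "k0 \<in> S first \<Longrightarrow> S first = UNIV" by blast
  define val :: "'m \<Rightarrow> 'm \<times> ('n \<Rightarrow> nat) \<Rightarrow> 'a" where
    "val k z = (if z = (k, \<lambda>_. 0) \<or> (k = k0 \<and> \<phi> z) then 1 else 0)" for k z
  have "\<exists>f. functional f \<and> (\<forall>z. \<not> principal z \<longrightarrow> f (adapted z) = val k z)" for k
    by (rule functional_with_values[of "val k"]) blast
  then obtain g where g: "\<And>k. functional (g k)"
    and gb: "\<And>k z. \<not> principal z \<Longrightarrow> g k (adapted z) = val k z" by metis
  have b0: "adapted (l, \<lambda>_. 0) = y l" for l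
    by (simp add: adapted_parametric not_principal_zero Y_def)
  have gy: "g k (y l) = (if k = l then 1 else 0)" for k l
    using gb[OF not_principal_zero, of k l] \<phi>0[of l "\<lambda>_. 0"] by (auto simp: b0 val_def)
  let ?\<sigma> = "spencer_op first"
  have shifted: "(?\<sigma> ^^ r) (g k0) (adapted (l, \<nu>)) = (-1) ^ r * (if \<phi> (l, \<nu>(first := \<nu> first + r)) then 1 else 0)"
    if "movable (l, \<nu>)" and "0 < r" for l \<nu> r
  proof -
    have gs: "g k0 ((d first ^^ t) (adapted (l, \<nu>))) = val k0 (l, \<nu>(first := \<nu> first + t))" for t
      using movable_shift[OF that(1), of t] by (simp add: gb movable_def)
    have "(?\<sigma> ^^ r) (g k0) (adapted (l, \<nu>)) = (-1) ^ r * g k0 ((d first ^^ r) (adapted (l, \<nu>)))"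
      by (rule spencer_op_power_constants) (simp add: gs val_def)
    moreover have "val k0 (l, \<nu>(first := \<nu> first + r)) = (if \<phi> (l, \<nu>(first := \<nu> first + r)) then 1 else 0)"
    proof -
      have "(\<nu>(first := \<nu> first + r)) first \<noteq> 0" using that(2) by simp
      then have "\<nu>(first := \<nu> first + r) \<noteq> (\<lambda>_. 0)" by metis
      then show ?thesis by (auto simp: val_def)
    qed
    ultimately show ?thesis by (simp only: gs)
  qed
  have gen: "\<exists>(X :: ('m \<times> ('n \<Rightarrow> nat)) set) a r c. \<forall>u\<in>span (Y ` {z. ord z \<le> q}).
      f u = (\<Sum>x\<in>X. a x * (?\<sigma> ^^ r x) (g k0) u) + (\<Sum>l\<in>UNIV. c l * g l u)"
    if f: "functional f" for f q
  proof -
    define X where "X = {x. movable x \<and> ord x \<le> q}"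
    have finX: "finite X" unfolding X_def by (rule finite_subset[OF _ finite_jet_index[of q]]) auto
    have "\<exists>r. \<forall>z\<in>X. (?\<sigma> ^^ r) (g k0) (adapted z) = (-1) ^ r * (if z = x then 1 else 0)" if x: "x \<in> X" for x
    proof -
      obtain k \<mu> where x': "x = (k, \<mu>)" by (cases x)
      then obtain r where r0: "0 < r" and r: "\<And>l \<nu>. mi_order \<nu> \<le> q \<Longrightarrow>
          \<phi> (l, \<nu>(first := \<nu> first + r)) \<longleftrightarrow> (l, \<nu>) = (k, \<mu>)"
        using \<phi>[of \<mu> q k] x by (auto simp: X_def)
      have "(?\<sigma> ^^ r) (g k0) (adapted z) = (-1) ^ r * (if z = x then 1 else 0)" if z: "z \<in> X" for z
      proof -
        obtain l \<nu> where z': "z = (l, \<nu>)" by (cases z)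
        have z2: "movable (l, \<nu>)" "mi_order \<nu> \<le> q" using z z' by (auto simp: X_def)
        then show ?thesis using shifted[OF z2(1) r0] r[OF z2(2), of l] x' z' by auto
      qed
      then show ?thesis by blast
    qed
    then obtain r where r: "\<And>x z. x \<in> X \<Longrightarrow> z \<in> X \<Longrightarrow>
        (?\<sigma> ^^ r x) (g k0) (adapted z) = (-1) ^ r x * (if z = x then 1 else 0)" by metis
    (* a matches f on the movable jets, c then repairs the remaining unknowns *)
    define a where "a x = (-1) ^ r x * f (adapted x)" for x
    define A where "A u = (\<Sum>x\<in>X. a x * (?\<sigma> ^^ r x) (g k0) u)" for u
    define c where "c l = (if l \<in> S first then f (y l) - A (y l) else 0)" for l
    have AX: "A (adapted z) = f (adapted z)" if z: "z \<in> X" for z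
    proof -
      have "A (adapted z) = (\<Sum>x\<in>X. if x = z then f (adapted z) else 0)"
        unfolding A_def by (intro sum.cong) (auto simp: r[OF _ z] a_def simp flip: power_add mult.assoc mult_2)
      then show ?thesis using finX z by simp
    qed
    have dual: "c l * g l (adapted z) = (if z = (l, \<lambda>_. 0) then c l else 0)" if np: "\<not> principal z" for l z
    proof (cases "l \<in> S first \<and> l = k0")
      case True
      then have "S first = UNIV" using k0 by blast
      then have "snd z = (\<lambda>_. 0)" using np positive_order_principal[of "snd z" "fst z"] by auto
      then show ?thesis using \<phi>0[of "fst z" "snd z"] gb[OF np, of l] by (cases z) (auto simp: val_def)
    next
      case False
      then show ?thesis using gb[OF np, of l] by (auto simp: val_def c_def)
    qed
    have "f u = A u + (\<Sum>l\<in>UNIV. c l * g l u)" if u: "u \<in> span (Y ` {z. ord z \<le> q})" for u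
    proof (rule functional_eq_on_jets[OF f _ _ u])
      show "functional (\<lambda>u. A u + (\<Sum>l\<in>UNIV. c l * g l u))"
        unfolding A_def by (intro functional_combination functional_spencer_op_power g)
    next
      fix x assume np: "\<not> principal x" and ox: "ord x \<le> q"
      show "f (adapted x) = A (adapted x) + (\<Sum>l\<in>UNIV. c l * g l (adapted x))"
      proof (cases "movable x")
        case True
        then have "c l * g l (adapted x) = 0" for l
          unfolding dual[OF np] using True by (auto simp: movable_def c_def)
        then have "(\<Sum>l\<in>UNIV. c l * g l (adapted x)) = 0" by (intro sum.neutral) blast
        moreover have "x \<in> X" using True ox by (simp add: X_def)
        ultimately show ?thesis by (simp add: AX)
      next
        case False
        then obtain k where k: "x = (k, \<lambda>_. 0)" "k \<in> S first"
          using np by (cases x) (auto simp: movable_def)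
        have "(\<Sum>l\<in>UNIV. c l * g l (adapted x)) = (\<Sum>l\<in>UNIV. if l = k then c l else 0)"
          unfolding dual[OF np] by (intro sum.cong) (auto simp: k(1))
        also have "\<dots> = c k" by simp
        finally show ?thesis using k by (simp add: c_def b0)
      qed
    qed
    then show ?thesis unfolding A_def by blast
  qed
  show thesis by (rule that[OF g gy gen])
qed

end

section \<open>Linear changes of the independent variables\<close>

context differential_module
begin

lemma der_sum: "der i (\<Sum>x\<in>X. h x) = (\<Sum>x\<in>X. der i (h x))"
  by (induction X rule: infinite_finite_induct) (simp_all add: der_add)

lemma d_sum: "d i (\<Sum>x\<in>X. h x) = (\<Sum>x\<in>X. d i (h x))"
  by (induction X rule: infinite_finite_induct) (simp_all add: d_add)

text \<open>
  The new derivations commute because the coefficients of the change are constants.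
\<close>

lemma linear_change_differential_module:
  assumes const: "\<And>i j l. der l (A i j) = 0"
  shows "differential_module (\<lambda>i a. \<Sum>j\<in>UNIV. A i j * der j a) s (\<lambda>i v. \<Sum>j\<in>UNIV. s (A i j) (d j v))"
proof unfold_locales
  fix i j a b and u v :: 'v
  show "(\<Sum>j\<in>UNIV. A i j * der j (a + b)) = (\<Sum>j\<in>UNIV. A i j * der j a) + (\<Sum>j\<in>UNIV. A i j * der j b)"
    by (simp add: der_add distrib_left sum.distrib)
  show "(\<Sum>j\<in>UNIV. A i j * der j (a * b)) = (\<Sum>j\<in>UNIV. A i j * der j a) * b + a * (\<Sum>j\<in>UNIV. A i j * der j b)"
    by (simp add: der_mult distrib_left sum.distrib sum_distrib_left sum_distrib_right mult_ac)
  show "(\<Sum>l\<in>UNIV. A i l * der l (\<Sum>k\<in>UNIV. A j k * der k a)) =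
        (\<Sum>l\<in>UNIV. A j l * der l (\<Sum>k\<in>UNIV. A i k * der k a))"
    by (simp add: der_sum der_mult const sum_distrib_left, subst sum.swap)
       (simp add: der_commute mult_ac)
  show "(\<Sum>j\<in>UNIV. s (A i j) (d j (u + v))) = (\<Sum>j\<in>UNIV. s (A i j) (d j u)) + (\<Sum>j\<in>UNIV. s (A i j) (d j v))"
    by (simp add: d_add scale_right_distrib sum.distrib)
  show "(\<Sum>j\<in>UNIV. s (A i j) (d j (s a v))) = s (\<Sum>j\<in>UNIV. A i j * der j a) v + s a (\<Sum>j\<in>UNIV. s (A i j) (d j v))"
    by (simp add: d_scale scale_right_distrib sum.distrib scale_sum_left scale_sum_right mult.commute)
  show "(\<Sum>l\<in>UNIV. s (A i l) (d l (\<Sum>k\<in>UNIV. s (A j k) (d k v)))) =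
        (\<Sum>l\<in>UNIV. s (A j l) (d l (\<Sum>k\<in>UNIV. s (A i k) (d k v))))"
    by (simp add: d_sum d_scale const scale_sum_right, subst sum.swap)
       (simp add: d_commute mult.commute)
qed

lemma linear_change_inverse:
  fixes A B :: "(('a, 'n) vec, 'n) vec"
  assumes "B ** A = mat 1"
  shows "(\<Sum>i\<in>UNIV. s (B $ j $ i) (\<Sum>l\<in>UNIV. s (A $ i $ l) (d l v))) = d j v"
proof -
  have "(\<Sum>i\<in>UNIV. s (B $ j $ i) (\<Sum>l\<in>UNIV. s (A $ i $ l) (d l v))) =
      (\<Sum>l\<in>UNIV. s ((B ** A) $ j $ l) (d l v))"
    by (simp add: scale_sum_right matrix_matrix_mult_def scale_sum_left) (rule sum.swap)
  also have "\<dots> = (\<Sum>l\<in>UNIV. if l = j then d l v else 0)"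
    by (intro sum.cong) (auto simp: assms mat_def)
  finally show ?thesis by simp
qed

end

section \<open>The module of jets and the module of sections\<close>

context differential_field
begin

lemma jderiv_superset:
  assumes "finite M" "Poly_Mapping.keys P \<subseteq> M"
  shows "jderiv der i P = (\<Sum>(k, \<mu>)\<in>M.
      Poly_Mapping.single (k, \<mu>) (der i (Poly_Mapping.lookup P (k, \<mu>))) +
      Poly_Mapping.single (k, incr i \<mu>) (Poly_Mapping.lookup P (k, \<mu>)))"
  unfolding jderiv_def using assms
  by (intro sum.mono_neutral_left) (auto simp: in_keys_iff)

lemma jderiv_add: "jderiv der i (P + Q) = jderiv der i P + jderiv der i Q"
proof -
  let ?M = "Poly_Mapping.keys P \<union> Poly_Mapping.keys Q"
  have "Poly_Mapping.keys (P + Q) \<subseteq> ?M" by (rule Poly_Mapping.keys_add)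
  then show ?thesis
    by (simp add: jderiv_superset[of ?M] lookup_add der_add single_add case_prod_unfold sum.distrib add_ac)
qed

lemma jscale_single: "jscale a (Poly_Mapping.single x c) = Poly_Mapping.single x (a * c)"
  by (rule poly_mapping_eqI) (simp add: lookup_single when_def)

lemma jderiv_jscale: "jderiv der i (jscale a P) = jscale (der i a) P + jscale a (jderiv der i P)"
proof -
  let ?M = "Poly_Mapping.keys P"
  have sub: "Poly_Mapping.keys (jscale a P) \<subseteq> ?M" by (auto simp: in_keys_iff)
  have P: "jscale (der i a) P = (\<Sum>(k, \<mu>)\<in>?M. Poly_Mapping.single (k, \<mu>) (der i a * Poly_Mapping.lookup P (k, \<mu>)))"
    by (rule poly_mapping_eqI)
       (auto simp: lookup_sum lookup_single when_def case_prod_unfold in_keys_iff)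
  show ?thesis
    unfolding jderiv_superset[OF finite_keys sub] P jderiv_def[of der i P]
    by (simp add: Dy.scale_sum_right Dy.scale_right_distrib jscale_single case_prod_unfold
        der_mult single_add sum.distrib add_ac)
qed

end

lemma jet_expansion:
  "P = (\<Sum>(k, \<mu>)\<in>Poly_Mapping.keys P. jscale (Poly_Mapping.lookup P (k, \<mu>)) (jet k \<mu>))"
  by (rule poly_mapping_eqI)
     (auto simp: lookup_sum lookup_single when_def case_prod_unfold in_keys_iff jet_def
       if_distrib[of "(*) _"] cong: if_cong)

lemma span_all_jets: "Dy.span (range (case_prod jet)) = (UNIV :: ('m, 'n, 'a::field) jetpoly set)"
proof -
  have "P \<in> Dy.span (range (case_prod jet))" for P :: "('m, 'n, 'a) jetpoly"
    by (subst jet_expansion[of P], intro Dy.span_sum)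
       (auto simp: case_prod_unfold intro: Dy.span_scale[OF Dy.span_base])
  then show ?thesis by blast
qed

lemma lookup_jet: "Poly_Mapping.lookup (jet k \<mu>) z = (if z = (k, \<mu>) then 1 else 0)"
  by (auto simp: jet_def lookup_single when_def)

lemma inj_jet: "inj (case_prod jet :: _ \<Rightarrow> ('m, 'n, 'a::field) jetpoly)"
proof (rule injI)
  fix x z :: "'m \<times> ('n \<Rightarrow> nat)"
  assume "(case_prod jet x :: ('m, 'n, 'a) jetpoly) = case_prod jet z"
  then have "Poly_Mapping.lookup (case_prod jet x :: ('m, 'n, 'a) jetpoly) z =
      Poly_Mapping.lookup (case_prod jet z :: ('m, 'n, 'a) jetpoly) z" by simp
  then show "x = z" by (auto simp: lookup_jet case_prod_unfold split: if_splits)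
qed

lemma independent_all_jets: "Dy.independent (range (case_prod jet) :: ('m, 'n, 'a::field) jetpoly set)"
proof (subst Dy.independent_explicit_module, intro allI impI)
  fix t u and v :: "('m, 'n, 'a) jetpoly"
  assume t: "finite t" "t \<subseteq> range (case_prod jet)" and zero: "(\<Sum>v\<in>t. jscale (u v) v) = 0" and v: "v \<in> t"
  obtain x where x: "v = case_prod jet x" using t v by blast
  have "u w * Poly_Mapping.lookup w x = (if w = v then u v else 0)" if w: "w \<in> t" for w
  proof -
    obtain z where z: "w = case_prod jet z" using t w by blast
    have "w = v \<longleftrightarrow> z = x" unfolding z x using injD[OF inj_jet] by blast
    then show ?thesis using z by (auto simp: lookup_jet case_prod_unfold)
  qed
  then have "(\<Sum>w\<in>t. u w * Poly_Mapping.lookup w x) = (\<Sum>w\<in>t. if w = v then u v else 0)"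
    by (intro sum.cong) auto
  also have "\<dots> = u v" using t v by simp
  finally show "u v = 0" using arg_cong[OF zero, of "\<lambda>P. Poly_Mapping.lookup P x"]
    by (simp add: lookup_sum)
qed

lemma differential_module_jets:
  fixes der :: "'n::{finite,linorder} \<Rightarrow> 'a::field_char_0 \<Rightarrow> 'a"
  assumes "differential_field der"
  shows "differential_module der (jscale :: _ \<Rightarrow> ('m, 'n, 'a) jetpoly \<Rightarrow> _) (jderiv der)"
proof -
  interpret differential_field der by fact
  show ?thesis
  proof unfold_locales
    fix i j and v :: "('m, 'n, 'a) jetpoly"
    have "v \<in> Dy.span (range (case_prod jet))" by (simp add: span_all_jets)
    then show "jderiv der i (jderiv der j v) = jderiv der j (jderiv der i v)"
    proof (induction rule: Dy.span_induct_alt)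
      case base
      show ?case by (simp add: jderiv_def)
    next
      case (step c x y)
      then show ?case
        by (auto simp: jderiv_add jderiv_jscale jderiv_jet incr_commute[of i j] der_commute[of i j] add_ac)
    qed
  qed (rule jderiv_add jderiv_jscale)+
qed

lemma differential_module_sections:
  fixes der :: "'n::{finite,linorder} \<Rightarrow> 'a::field_char_0 \<Rightarrow> 'a"
  assumes "differential_field der"
  shows "differential_module der
    (section_scale :: _ \<Rightarrow> (('m, 'n, 'a) jetpoly \<Rightarrow> 'a) \<Rightarrow> _) (spencer der)"
proof -
  interpret jets: differential_module der "jscale :: _ \<Rightarrow> ('m, 'n, 'a) jetpoly \<Rightarrow> _" "jderiv der"
    using assms by (rule differential_module_jets)
  have diff: "der i (a - b) = der i a - der i b" for i a b
    using jets.der_add[of i "a - b" b] by simp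
  show ?thesis
    by unfold_locales
      (auto simp: section_scale_def spencer_def fun_eq_iff jets.der_add jets.der_mult diff
        jets.der_commute jets.d_commute algebra_simps)
qed

section \<open>Generation of the module of sections\<close>

theorem theorem3p38:
  fixes der :: "'n::{finite,linorder} \<Rightarrow> 'a::field_char_0 \<Rightarrow> 'a"
    and \<Phi> :: "('m::finite, 'n, 'a) jetpoly set"
  assumes "differential_field der"
    and "finite \<Phi>" and "\<Phi> \<subseteq> jets_upto 1"
    and "involutive der \<Phi>"
    and "no_zero_order_equation \<Phi>"
  shows "\<exists>G. finite G \<and> card G = CARD('m) \<and> generates der \<Phi> G"
proof -
  let ?jscale = "jscale :: 'a \<Rightarrow> ('m, 'n, 'a) jetpoly \<Rightarrow> _"
  let ?y = "unknown :: 'm \<Rightarrow> ('m, 'n, 'a) jetpoly"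
  interpret jets: differential_module der ?jscale "jderiv der"
    using assms(1) by (rule differential_module_jets)
  obtain A S E Z where A: "linear_change der A" and sol: "solved_form der A \<Phi> S E Z"
    and inv: "Dy.span (\<Phi> \<union> {jderiv der i P | i P. P \<in> \<Phi>}) =
     Dy.span (\<Phi> \<union> {new_deriv der A j (E i k) | i j k. k \<in> S i \<and> j \<le> i})"
    using assms(4) unfolding involutive_def by blast
  obtain B where BA: "B ** A = mat 1"
    using A unfolding linear_change_def invertible_def by blast
  define der' where "der' = (\<lambda>i a. \<Sum>j\<in>UNIV. A $ i $ j * der j a)"
  let ?\<delta> = "new_deriv der A :: 'n \<Rightarrow> ('m, 'n, 'a) jetpoly \<Rightarrow> _"
  have \<delta>: "?\<delta> = (\<lambda>i v. \<Sum>j\<in>UNIV. jscale (A $ i $ j) (jderiv der j v))"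
    by (simp add: new_deriv_def fun_eq_iff)
  interpret new: differential_module der' ?jscale ?\<delta>
    unfolding \<delta> der'_def
    using A by (intro jets.linear_change_differential_module) (simp add: linear_change_def)
  have old: "jderiv der j v = (\<Sum>i\<in>UNIV. jscale (B $ j $ i) (?\<delta> i v))" for j v
    using jets.linear_change_inverse[OF BA, of j v] by (simp add: \<delta>)

  \<comment> \<open>The old jets lie in the span of the new ones of the same order, as the change is invertible;
    by counting, the new jets are again independent.\<close>
  let ?Y = "\<lambda>(k, \<mu>). dpower ?\<delta> \<mu> (?y k)"
  let ?idx = "\<lambda>q. {z :: 'm \<times> ('n \<Rightarrow> nat). mi_order (snd z) \<le> q}"
  have jet_in: "jet k \<mu> \<in> Dy.span (?Y ` ?idx q)" if "mi_order \<mu> \<le> q" for k \<mu> q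
    using that
  proof (induction \<mu> arbitrary: q rule: multi_index_induct)
    case zero
    have "jet k (\<lambda>_. 0) = ?Y (k, \<lambda>_. 0)" by simp
    then show ?case by (auto intro!: Dy.span_base image_eqI[of _ _ "(k, \<lambda>_. 0)"])
  next
    case (incr i \<mu>)
    then obtain p where p: "q = Suc p" "mi_order \<mu> \<le> p" by (cases q) auto
    have Y: "?Y z \<in> Dy.span (?Y ` ?idx q)" if "mi_order (snd z) \<le> q" for z
      using that by (intro Dy.span_base) auto
    have "?\<delta> j (jet k \<mu>) \<in> Dy.span (?Y ` ?idx q)" for j
    proof (rule new.d_in_span[OF incr.IH[OF p(2)]])
      fix x assume "x \<in> ?Y ` ?idx p"
      then obtain l \<nu> where x: "x = ?Y (l, \<nu>)" "mi_order \<nu> \<le> p" by auto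
      show "x \<in> Dy.span (?Y ` ?idx q)" unfolding x(1) using x(2) p by (intro Y) simp
      have "?\<delta> j x = ?Y (l, incr j \<nu>)" by (simp add: x(1) new.dpower_incr)
      then show "?\<delta> j x \<in> Dy.span (?Y ` ?idx q)" using Y[of "(l, incr j \<nu>)"] x(2) p by simp
    qed
    then have "jderiv der i (jet k \<mu>) \<in> Dy.span (?Y ` ?idx q)"
      unfolding old by (intro Dy.span_sum Dy.span_scale)
    then show ?case by (simp add: jets.jderiv_jet)
  qed
  have fam: "inj_on ?Y (?idx q) \<and> Dy.independent (?Y ` ?idx q)" for q
  proof (rule Dy.independent_family_exchange[OF finite_jet_index])
    show "inj_on (case_prod jet :: _ \<Rightarrow> ('m, 'n, 'a) jetpoly) (?idx q)"
      using inj_jet by (rule inj_on_subset) simp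
    show "Dy.independent ((case_prod jet :: _ \<Rightarrow> ('m, 'n, 'a) jetpoly) ` ?idx q)"
      by (rule Dy.independent_mono[OF independent_all_jets]) auto
    show "case_prod jet ` ?idx q \<subseteq> Dy.span (?Y ` ?idx q)" using jet_in by auto
  qed
  let ?E = "{E i k | i k. k \<in> S i}"
  have \<Phi>E: "Dy.span \<Phi> = Dy.span ?E"
  proof -
    have sp: "Dy.span \<Phi> = Dy.span (?E \<union> Z)" and "Z \<subseteq> jets_upto 0"
      using sol by (simp_all add: solved_form_def)
    moreover have "Z \<subseteq> Dy.span \<Phi>" unfolding sp by (auto intro: Dy.span_base)
    ultimately have "Z \<subseteq> {0}" using assms(5) unfolding no_zero_order_equation_def by blast
    then have "Dy.span (?E \<union> Z) \<subseteq> Dy.span ?E"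
      by (intro Dy.span_minimal) (auto intro: Dy.span_base Dy.span_zero)
    then show ?thesis unfolding sp using Dy.span_mono[of ?E "?E \<union> Z"] by blast
  qed
  interpret solved_system der' ?jscale ?\<delta> ?y S E
  proof
    show "inj ?Y" by (rule Dy.independent_family_filtration(1)[OF fam])
    show "Dy.independent (range ?Y)" by (rule Dy.independent_family_filtration(2)[OF fam])
  next
    fix k i assume "k \<in> S i"
    then show "E i k - ?\<delta> i (?y k) \<in> Dy.span ({?\<delta> i (?y l) | l. l \<notin> S i} \<union>
        {?\<delta> j (?y l) | j l. j < i} \<union> range ?y)"
      using sol by (simp add: solved_form_def)
  next
    fix k i j assume k: "k \<in> S i"
    let ?P = "{?\<delta> j' (E i' k') | i' j' k'. k' \<in> S i' \<and> j' \<le> i'}"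
    have E: "E i k \<in> Dy.span \<Phi>" unfolding \<Phi>E using k by (intro Dy.span_base) blast
    have "jderiv der l (E i k) \<in> Dy.span (\<Phi> \<union> {jderiv der i P | i P. P \<in> \<Phi>})" for l
      by (rule jets.d_in_span[OF E]) (auto intro: Dy.span_base)
    then have "?\<delta> j (E i k) \<in> Dy.span (\<Phi> \<union> {jderiv der i P | i P. P \<in> \<Phi>})"
      unfolding \<delta> by (intro Dy.span_sum Dy.span_scale)
    also have "\<dots> = Dy.span (\<Phi> \<union> ?P)" by (rule inv)
    also have "\<dots> \<subseteq> Dy.span (?E \<union> ?P)"
    proof (rule Dy.span_minimal)
      have "\<Phi> \<subseteq> Dy.span ?E" using \<Phi>E Dy.span_superset by blast
      also have "\<dots> \<subseteq> Dy.span (?E \<union> ?P)" by (rule Dy.span_mono) simp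
      finally show "\<Phi> \<union> ?P \<subseteq> Dy.span (?E \<union> ?P)" by (auto intro: Dy.span_base)
    qed simp
    finally show "?\<delta> j (E i k) \<in> Dy.span (?E \<union> ?P)" .
  qed

  have IJ: "system_module der \<Phi> = J"
    unfolding system_module_def jets.D_span_eq_D_submodule
  proof
    show "jets.D_submodule \<Phi> \<subseteq> J"
    proof (rule jets.D_submodule_minimal)
      have "Dy.span ?E \<subseteq> J" unfolding J_def
        using E_in_J unfolding J_def by (intro Dy.span_minimal) auto
      then show "\<Phi> \<subseteq> J" using \<Phi>E Dy.span_superset by blast
      show "Dy.subspace J" by (simp add: J_def)
      show "jderiv der i v \<in> J" if "v \<in> J" for i v
        unfolding old J_def using d_in_J[OF that] unfolding J_def
        by (intro Dy.span_sum Dy.span_scale)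
    qed
    show "J \<subseteq> jets.D_submodule \<Phi>"
    proof (rule J_subset)
      show "Dy.subspace (jets.D_submodule \<Phi>)" by (rule jets.subspace_D_submodule)
      show "?\<delta> i v \<in> jets.D_submodule \<Phi>" if "v \<in> jets.D_submodule \<Phi>" for i v
        unfolding \<delta> using jets.d_D_submodule[OF that] jets.subspace_D_submodule
        by (intro Dy.subspace_sum Dy.subspace_scale)
      have "Dy.span \<Phi> \<subseteq> jets.D_submodule \<Phi>"
        by (intro Dy.span_minimal jets.subset_D_submodule jets.subspace_D_submodule)
      then show "E i k \<in> jets.D_submodule \<Phi>" if "k \<in> S i" for i k
        using that Dy.span_base[of "E i k" ?E] unfolding \<Phi>E by blast
    qed
  qed
  have sections_iff: "f \<in> sections der \<Phi> \<longleftrightarrow> functional f" for f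
    by (simp add: sections_def functional_def IJ)

  interpret R: differential_module der "section_scale :: 'a \<Rightarrow> (('m, 'n, 'a) jetpoly \<Rightarrow> 'a) \<Rightarrow> _" "spencer der"
    using assms(1) by (rule differential_module_sections)
  obtain g :: "'m \<Rightarrow> ('m, 'n, 'a) jetpoly \<Rightarrow> 'a" and k0
    where g: "\<And>k. functional (g k)"
    and gy: "\<And>k l. g k (?y l) = (if k = l then 1 else 0)"
    and gen: "\<And>f q. functional f \<Longrightarrow> \<exists>(X :: ('m \<times> ('n \<Rightarrow> nat)) set) a r c. \<forall>u\<in>Dy.span (Y ` ?idx q).
      f u = (\<Sum>x\<in>X. a x * (new.spencer_op first ^^ r x) (g k0) u) + (\<Sum>l\<in>UNIV. c l * g l u)"
    by (rule generating_functionals) blast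
  let ?M = "R.D_submodule (range g)"
  \<comment> \<open>On linear forms the Spencer operators of the new variables are the same constant combinations
    of those of the old variables, hence they stay within the generated submodule.\<close>
  have sp: "new.spencer_op i f \<in> ?M" if f: "functional f" "f \<in> ?M" for f i
  proof -
    have lin: "Vector_Spaces.linear ?jscale (*) f" using f(1) by (simp add: functional_def)
    then interpret f: Vector_Spaces.linear ?jscale "(*)" f .
    have "new.spencer_op i f = (\<Sum>j\<in>UNIV. section_scale (A $ i $ j) (spencer der j f))"
    proof
      fix u
      have app: "(\<Sum>j\<in>X. h j) u = (\<Sum>j\<in>X. h j u)" for h :: "'n \<Rightarrow> ('m, 'n, 'a) jetpoly \<Rightarrow> 'a" and X
        by (induction X rule: infinite_finite_induct) auto
      show "new.spencer_op i f u = (\<Sum>j\<in>UNIV. section_scale (A $ i $ j) (spencer der j f)) u"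
        unfolding app new.spencer_op_apply
        by (simp add: der'_def \<delta> f.sum f.scale section_scale_def spencer_def
            right_diff_distrib sum_subtractf)
    qed
    also have "\<dots> \<in> ?M"
      using R.d_D_submodule[OF f(2)] R.subspace_D_submodule
      by (intro R.subspace_sum R.subspace_scale)
    finally show ?thesis .
  qed
  have g_in: "g k \<in> ?M" for k using R.subset_D_submodule by blast
  have pow: "(new.spencer_op i ^^ r) (g k) \<in> ?M" for i r k
    by (induction r) (auto intro: sp g_in functional_spencer_op_power g)
  have "generates der \<Phi> (range g)"
    unfolding generates_def
  proof (intro conjI ballI allI)
    show "range g \<subseteq> sections der \<Phi>" using g sections_iff by blast
  next
    fix f q assume "f \<in> sections der \<Phi>"
    then obtain X :: "('m \<times> ('n \<Rightarrow> nat)) set" and a r c where f: "\<And>u. u \<in> Dy.span (Y ` ?idx q) \<Longrightarrow>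
      f u = (\<Sum>x\<in>X. a x * (new.spencer_op first ^^ r x) (g k0) u) + (\<Sum>l\<in>UNIV. c l * g l u)"
      using gen[of f q] sections_iff by blast
    define h where "h = (\<Sum>x\<in>X. section_scale (a x) ((new.spencer_op first ^^ r x) (g k0))) +
        (\<Sum>l\<in>UNIV. section_scale (c l) (g l))"
    have app: "(\<Sum>x\<in>W. w x) u = (\<Sum>x\<in>W. w x u)" for w :: "'w \<Rightarrow> ('m, 'n, 'a) jetpoly \<Rightarrow> 'a" and W u
      by (induction W rule: infinite_finite_induct) auto
    have "h \<in> ?M" unfolding h_def using R.subspace_D_submodule pow g_in
      by (intro R.subspace_add R.subspace_sum R.subspace_scale)
    moreover have "h (jet k \<mu>) = f (jet k \<mu>)" if "mi_order \<mu> \<le> q" for k \<mu>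
    proof -
      have "jet k \<mu> \<in> Dy.span (Y ` ?idx q)" using jet_in[OF that] by (simp add: Y_def)
      then show ?thesis by (simp add: f h_def app section_scale_def)
    qed
    ultimately show "\<exists>h\<in>D_span section_scale (spencer der) (range g).
        \<forall>k \<mu>. mi_order \<mu> \<le> q \<longrightarrow> h (jet k \<mu>) = f (jet k \<mu>)"
      unfolding R.D_span_eq_D_submodule by blast
  qed
  moreover have "inj g"
  proof (rule injI)
    fix k l assume "g k = g l"
    then have "g k (?y l) = g l (?y l)" by simp
    then show "k = l" by (simp add: gy split: if_splits)
  qed
  then have "card (range g) = CARD('m)" by (rule card_image)
  ultimately show ?thesis by (intro exI[of _ "range g"]) simp
qed

end
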